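(* Let $r=16$ or $r=17$. Let $F$ be a form of degree $6$ in $4$ variables over $\mathbb{C}$, with a non-redundant decomposition $A\subset\mathbb{P}^3$ of length $r$ which is in General Position. Assume that the base locus of the system of cubic surfaces through $A$ contains no curves. Then $A$ is the unique minimal decomposition of $F$ (i.e. $F$ has Waring rank $r$ and $A$ is the only decomposition of $F$ of length $r$).
   Context: All polynomials are over $\mathbb{C}$. Linear forms in $4$ variables, up to scalar, are regarded as points of a projective space $\mathbb{P}^3$, and forms of degree $6$ in $4$ variables, up to scalar, as points of $\mathbb{P}^{83}$; $v_6:\mathbb{P}^3\to\mathbb{P}^{83}$, $L\mapsto L^6$, is the $6$-Veronese map. The length $\ell(A)$ of a finite set $A$ is its cardinality. A decomposition of $F$ of length $r$ is a finite set $A=\{L_1,\dots,L_r\}\subset\mathbb{P}^3$ such that $F=\sum_{i=1}^r a_iL_i^6$ for some $a_i\in\mathbb{C}$, i.e. $F$ belongs to the linear span $\langle v_6(A)\rangle$. It is non-redundant if the powers $L_1^6,\dots,L_r^6$ are linearly independent and no coefficient $a_i$ is $0$; equivalently, $F\notin\langle v_6(A')\rangle$ for every proper subset $A'\subsetneq A$. The Waring rank of $F$ is the minimal length of a decomposition of $F$; a decomposition is minimal if its length equals the Waring rank. A finite set $A\subset\mathbb{P}^3$ is in General Position if every subset $A'\subseteq A$ has maximal Hilbert function, i.e. $h_{A'}(i)=\min\{\ell(A'),\binom{i+3}{3}\}$ for all $i\ge 0$. *)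

theory Defs
  imports "HOL-Analysis.Analysis" "HOL-Library.Poly_Mapping" "HOL-Library.Numeral_Type"
    "HOL-Library.Extended_Nat"
begin

section \<open>Forms in four variables\<close>

text \<open>
  Exponent vectors are indexed by the four-element type \<open>4\<close>, so this type is
  the polynomial ring over the complex numbers in exactly four variables, with the ring
  structure of \<open>HOL-Library.Poly_Mapping\<close>. It is used both for the sextics being decomposed
  and for the forms on the projective space of linear forms (quadrics, cubics, ... through
  a set of points).
\<close>

type_synonym cpoly = "(4 \<Rightarrow>\<^sub>0 nat) \<Rightarrow>\<^sub>0 complex"

definition cscale :: "complex \<Rightarrow> cpoly \<Rightarrow> cpoly" where
  "cscale c p = Poly_Mapping.single 0 c * p"

global_interpretation cpoly: vector_space cscale
  by unfold_locales
    (simp_all add: cscale_def distrib_left distrib_right single_add mult_single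
      flip: mult.assoc)

definition forms :: "nat \<Rightarrow> cpoly set" where
  "forms d = {p. \<forall>m\<in>Poly_Mapping.keys p. (\<Sum>i\<in>UNIV. Poly_Mapping.lookup m i) = d}"

definition eval :: "cpoly \<Rightarrow> complex ^ 4 \<Rightarrow> complex" where
  "eval p x = (\<Sum>m\<in>Poly_Mapping.keys p.
     Poly_Mapping.lookup p m * (\<Prod>i\<in>UNIV. x $ i ^ Poly_Mapping.lookup m i))"

definition linform :: "complex ^ 4 \<Rightarrow> cpoly" where
  "linform v = (\<Sum>i\<in>UNIV. Poly_Mapping.single (Poly_Mapping.single i 1) (v $ i))"


section \<open>The projective space of linear forms\<close>

text \<open>
  A point is the class of a nonzero coefficient vector of a linear form modulo scalars.
\<close>

definition proportional :: "complex ^ 4 \<Rightarrow> complex ^ 4 \<Rightarrow> bool" where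
  "proportional u v \<longleftrightarrow> u \<noteq> 0 \<and> v \<noteq> 0 \<and> (\<exists>c. v = c *s u)"

quotient_type P3 = "complex ^ 4" / partial: proportional
proof (rule part_equivpI)
  show "\<exists>x. proportional x x"
    by (intro exI[of _ "axis 0 1"]) (auto simp: proportional_def intro!: exI[of _ 1])
  show "symp proportional"
  proof (rule sympI)
    fix u v assume a: "proportional u v"
    then obtain c where c: "v = c *s u" by (auto simp: proportional_def)
    with a have "c \<noteq> 0" by (auto simp: proportional_def)
    then have "u = inverse c *s v" by (simp add: c)
    with a show "proportional v u" unfolding proportional_def by blast
  qed
  show "transp proportional"
    by (rule transpI) (auto simp: proportional_def)
qed

text \<open>
  \<open>rep_P3\<close> selects a representative. The notions below do not depend on the selection:
  another choice rescales \<open>L\<close>, hence \<open>L ^ 6\<close>, and the value of a form, by a nonzero factor.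
\<close>

lemma rep_P3_nonzero: "rep_P3 P \<noteq> 0"
  using Quotient3_rep_reflp[OF Quotient3_P3] by (auto simp: proportional_def)

definition vanishes_at :: "cpoly \<Rightarrow> P3 \<Rightarrow> bool" where
  "vanishes_at G P \<longleftrightarrow> eval G (rep_P3 P) = 0"


section \<open>Waring decompositions of sextics\<close>

definition veronese6 :: "P3 \<Rightarrow> cpoly" where
  "veronese6 P = linform (rep_P3 P) ^ 6"

definition decomposition :: "cpoly \<Rightarrow> P3 set \<Rightarrow> bool" where
  "decomposition F A \<longleftrightarrow> finite A \<and> (\<exists>a. F = (\<Sum>P\<in>A. cscale (a P) (veronese6 P)))"

definition nonredundant_decomposition :: "cpoly \<Rightarrow> P3 set \<Rightarrow> bool" where
  "nonredundant_decomposition F A \<longleftrightarrow>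
     finite A \<and>
     inj_on veronese6 A \<and> cpoly.independent (veronese6 ` A) \<and>
     (\<exists>a. (\<forall>P\<in>A. a P \<noteq> 0) \<and> F = (\<Sum>P\<in>A. cscale (a P) (veronese6 P)))"

definition waring_rank :: "cpoly \<Rightarrow> nat" where
  "waring_rank F = (LEAST r. \<exists>A. decomposition F A \<and> card A = r)"

definition minimal_decomposition :: "cpoly \<Rightarrow> P3 set \<Rightarrow> bool" where
  "minimal_decomposition F A \<longleftrightarrow> decomposition F A \<and> card A = waring_rank F"


section \<open>Hilbert functions and General Position\<close>

definition forms_through :: "nat \<Rightarrow> P3 set \<Rightarrow> cpoly set" where
  "forms_through d A = {G \<in> forms d. \<forall>P\<in>A. vanishes_at G P}"

text \<open>
  The dimension of the degree \<open>i\<close> part of the homogeneous coordinate ring of \<open>A\<close>;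
  the natural subtraction does not truncate, since \<open>forms i\<close> is finite-dimensional.
\<close>

definition hilbert_function :: "P3 set \<Rightarrow> nat \<Rightarrow> nat" where
  "hilbert_function A i = cpoly.dim (forms i) - cpoly.dim (forms_through i A)"

definition general_position :: "P3 set \<Rightarrow> bool" where
  "general_position A \<longleftrightarrow> finite A \<and>
     (\<forall>A'\<subseteq>A. \<forall>i. hilbert_function A' i = min (card A') ((i + 3) choose 3))"


section \<open>Curves and base loci\<close>

definition zariski_closed :: "P3 set \<Rightarrow> bool" where
  "zariski_closed Z \<longleftrightarrow> (\<exists>S. S \<subseteq> (\<Union>d. forms d) \<and> Z = {P. \<forall>G\<in>S. vanishes_at G P})"

definition irreducible_closed :: "P3 set \<Rightarrow> bool" where
  "irreducible_closed Z \<longleftrightarrow> zariski_closed Z \<and> Z \<noteq> {} \<and>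
     (\<forall>Z1 Z2. zariski_closed Z1 \<and> zariski_closed Z2 \<and> Z = Z1 \<union> Z2 \<longrightarrow> Z = Z1 \<or> Z = Z2)"

text \<open>
  Krull dimension of a nonempty closed set (the empty set gets the value \<open>0\<close>).
\<close>

definition krull_dim :: "P3 set \<Rightarrow> enat" where
  "krull_dim Z = Sup {enat n | n. \<exists>C :: nat \<Rightarrow> P3 set.
     (\<forall>i\<le>n. irreducible_closed (C i) \<and> C i \<subseteq> Z) \<and> (\<forall>i<n. C i \<subset> C (Suc i))}"

text \<open>
  Only irreducible curves are considered; as every curve has an irreducible component,
  this makes no difference to whether a set contains a curve.
\<close>

definition is_curve :: "P3 set \<Rightarrow> bool" where
  "is_curve C \<longleftrightarrow> irreducible_closed C \<and> krull_dim C = 1"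

definition base_locus :: "nat \<Rightarrow> P3 set \<Rightarrow> P3 set" where
  "base_locus d A = {P. \<forall>G\<in>forms_through d A. vanishes_at G P}"

end

theory Submission
  imports Defs "HOL-Computational_Algebra.Field_as_Ring" "HOL-Computational_Algebra.Polynomial_Factorial"
    "HOL-Computational_Algebra.Fundamental_Theorem_Algebra"
begin

text \<open>
  Let \<open>B\<close> be a decomposition with at most \<open>r\<close> points. The difference of the two expressions for \<open>F\<close> is a
  relation with nonzero coefficients among the powers of the points of some \<open>Z \<subseteq> A \<union> B\<close>. By apolarity it is
  a relation among the evaluations of sextics at \<open>Z\<close>, so the values of cubics on \<open>Z\<close> form an isotropic space for
  a nondegenerate quadratic form. Since \<open>Z \<inter> A\<close> makes up at least half of \<open>Z\<close> and cubics separate its points,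
  every cubic through \<open>A\<close> vanishes on \<open>Z\<close>. The base locus of these cubics is finite, as an infinite closed set
  contains a curve. Hence the cubics restrict to a base point free system on a plane missing the base locus, and
  by Macaulay's bound their multiples fill the degrees from \<open>7 = 3 \<cdot> (3 - 1) + 1\<close> on. It follows that sextics
  already separate the points of \<open>Z\<close>, so \<open>Z\<close> is empty and \<open>A \<subseteq> B\<close>.
\<close>

section \<open>Graded families of form functions\<close>

text \<open>Degree 6 is the exact threshold of the last step. A complete intersection of three
  cubics in three-space consists of at most 27 points. If there are 27, they satisfy a relation
  among the values of quintics, in degree \<open>3 + 3 + 3 - 4\<close>, but none among the values of
  sextics. The relation that comes from two decompositions of a sextic lives in the first degree in
  which it is impossible. No three cubics of the system are ever selected. On the plane, two members
  without common zero on a line are chosen, and the whole system takes the place of the third.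
  Cancelling the equation of the line then needs only the Koszul syzygies of two binary cubics, so
  that Hilbert series and general position of three members are avoided. Forms are functions on
  nested products with one variable per factor. Restriction to a coordinate hyperplane, and division
  by its equation, are then read off from the recursion, while polynomial mappings appear only where
  the given definitions are met.\<close>

lemma nontrivial_solution:
  fixes M :: "'i \<Rightarrow> 'j \<Rightarrow> 'a::field"
  assumes "finite B" "finite I" "card B < card I"
  shows "\<exists>x. (\<exists>i\<in>I. x i \<noteq> 0) \<and> (\<forall>j\<in>B. (\<Sum>i\<in>I. x i * M i j) = 0)"
  using assms
proof (induction B arbitrary: I M rule: finite_induct)
  case empty
  then have "I \<noteq> {}" by auto
  then show ?case by (intro exI[of _ "\<lambda>_. 1"]) auto
next
  case (insert b B)
  show ?case
  proof (cases "\<forall>i\<in>I. M i b = 0")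
    case True
    have "card B < card I" using insert by simp
    from insert.IH[OF insert.prems(1) this, of M] True show ?thesis by auto
  next
    case False
    then obtain k where k: "k \<in> I" "M k b \<noteq> 0" by auto
    have "card B < card (I - {k})" using insert k by simp
    from insert.IH[OF _ this, of "\<lambda>i j. M i j - M i b / M k b * M k j"] insert.prems
    obtain x i0 where x: "i0 \<in> I - {k}" "x i0 \<noteq> 0"
      "\<And>j. j \<in> B \<Longrightarrow> (\<Sum>i\<in>I - {k}. x i * (M i j - M i b / M k b * M k j)) = 0" by auto
    define s where "s = (\<Sum>i\<in>I - {k}. x i * M i b)"
    define y where "y = x(k := - s / M k b)"
    have split: "(\<Sum>i\<in>I. y i * M i j) = - s / M k b * M k j + (\<Sum>i\<in>I - {k}. x i * M i j)" for j
    proof -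
      have "(\<Sum>i\<in>I. y i * M i j) = y k * M k j + (\<Sum>i\<in>I - {k}. y i * M i j)"
        using insert.prems k by (simp add: sum.remove)
      also have "(\<Sum>i\<in>I - {k}. y i * M i j) = (\<Sum>i\<in>I - {k}. x i * M i j)"
        by (rule sum.cong) (auto simp: y_def)
      finally show ?thesis by (simp add: y_def)
    qed
    have "(\<Sum>i\<in>I. y i * M i j) = 0" if "j \<in> insert b B" for j
    proof (cases "j = b")
      case True
      then show ?thesis using k by (simp add: split s_def)
    next
      case False
      with that have "j \<in> B" by simp
      from x(3)[OF this] have "(\<Sum>i\<in>I - {k}. x i * M i j) = s / M k b * M k j"
        by (simp add: s_def algebra_simps sum_subtractf sum_distrib_left sum_divide_distrib)
      then show ?thesis by (simp add: split)
    qed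
    moreover have "i0 \<in> I" "y i0 \<noteq> 0" using x by (auto simp: y_def)
    ultimately show ?thesis by blast
  qed
qed

text \<open>Only closure properties are recorded, and the pieces may overlap: the constant family
  \<open>\<lambda>_. affine_poly\<close> is an instance too, so that substitution results also cover
  dehomogenisation.\<close>

definition graded :: "(nat \<Rightarrow> ('v \<Rightarrow> complex) set) \<Rightarrow> bool" where
  "graded K \<longleftrightarrow> (\<forall>d. (\<lambda>_. 0) \<in> K d) \<and> (\<forall>c. (\<lambda>_. c) \<in> K 0) \<and>
     (\<forall>d f g. f \<in> K d \<longrightarrow> g \<in> K d \<longrightarrow> (\<lambda>v. f v + g v) \<in> K d) \<and>
     (\<forall>d e f g. f \<in> K d \<longrightarrow> g \<in> K e \<longrightarrow> (\<lambda>v. f v * g v) \<in> K (d + e))"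

lemma graded_zero: "graded K \<Longrightarrow> (\<lambda>_. 0) \<in> K d"
  and graded_const: "graded K \<Longrightarrow> (\<lambda>_. c) \<in> K 0"
  and graded_add: "graded K \<Longrightarrow> f \<in> K d \<Longrightarrow> g \<in> K d \<Longrightarrow> (\<lambda>v. f v + g v) \<in> K d"
  and graded_mult: "graded K \<Longrightarrow> f \<in> K d \<Longrightarrow> g \<in> K e \<Longrightarrow> (\<lambda>v. f v * g v) \<in> K (d + e)"
  by (auto simp: graded_def)

lemma graded_scale: "graded K \<Longrightarrow> f \<in> K d \<Longrightarrow> (\<lambda>v. c * f v) \<in> K d"
  using graded_mult[of K "\<lambda>_. c" 0 f d] graded_const[of K c] by simp

lemma graded_diff: "graded K \<Longrightarrow> f \<in> K d \<Longrightarrow> g \<in> K d \<Longrightarrow> (\<lambda>v. f v - g v) \<in> K d"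
  using graded_add[of K f d "\<lambda>v. - 1 * g v"] graded_scale[of K g d "-1"] by simp

lemma graded_sum:
  assumes "graded K" "\<And>i. i \<in> I \<Longrightarrow> f i \<in> K d"
  shows "(\<lambda>v. \<Sum>i\<in>I. f i v) \<in> K d"
  using assms(2) by (induction I rule: infinite_finite_induct)
    (auto intro: graded_zero[OF assms(1)] graded_add[OF assms(1)])

lemma graded_prod:
  assumes "graded K" "finite I" "\<And>i. i \<in> I \<Longrightarrow> f i \<in> K (e i)"
  shows "(\<lambda>v. \<Prod>i\<in>I. f i v) \<in> K (\<Sum>i\<in>I. e i)"
  using assms(2,3) by (induction I rule: finite_induct)
    (auto intro: graded_const[OF assms(1)] graded_mult[OF assms(1)])

lemma graded_power:
  assumes "graded K" "f \<in> K d"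
  shows "(\<lambda>v. f v ^ n) \<in> K (d * n)"
  using graded_prod[OF assms(1), of "{..<n}" "\<lambda>_. f" "\<lambda>_. d"] assms(2) by (simp add: mult.commute)

text \<open>
  Forms are treated as functions. Splitting off the first variable, a form of positive degree is \<open>x * G + q\<close>
  with \<open>q\<close> independent of \<open>x\<close>.
\<close>

fun ext :: "(nat \<Rightarrow> ('v \<Rightarrow> complex) set) \<Rightarrow> nat \<Rightarrow> (complex \<times> 'v \<Rightarrow> complex) set" where
  "ext H 0 = {\<lambda>z. q (snd z) | q. q \<in> H 0}"
| "ext H (Suc d) = {\<lambda>z. fst z * G z + q (snd z) | G q. G \<in> ext H d \<and> q \<in> H (Suc d)}"

lemma ext_SucI: "G \<in> ext H d \<Longrightarrow> q \<in> H (Suc d) \<Longrightarrow> (\<lambda>z. fst z * G z + q (snd z)) \<in> ext H (Suc d)"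
  by auto

lemma zero_in_ext: "graded H \<Longrightarrow> (\<lambda>_. 0) \<in> ext H d"
proof (induction d)
  case 0
  then show ?case by (auto intro!: exI[of _ "\<lambda>_. 0"] graded_zero)
next
  case (Suc d)
  from ext_SucI[OF Suc.IH[OF Suc.prems] graded_zero[OF Suc.prems]] show ?case by simp
qed

lemma ext_snd: "graded H \<Longrightarrow> q \<in> H d \<Longrightarrow> (\<lambda>z. q (snd z)) \<in> ext H d"
proof (cases d)
  case (Suc e)
  assume "graded H" "q \<in> H d"
  with ext_SucI[OF zero_in_ext[of H e], of q] Suc show ?thesis by simp
qed auto

lemma ext_fst_mult: "graded H \<Longrightarrow> G \<in> ext H d \<Longrightarrow> (\<lambda>z. fst z * G z) \<in> ext H (Suc d)"
  using ext_SucI[of G H d "\<lambda>_. 0"] graded_zero[of H] by simp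

lemma ext_add:
  assumes "graded H"
  shows "f \<in> ext H d \<Longrightarrow> g \<in> ext H d \<Longrightarrow> (\<lambda>z. f z + g z) \<in> ext H d"
proof (induction d arbitrary: f g)
  case 0
  then obtain p q where "f = (\<lambda>z. p (snd z))" "p \<in> H 0" "g = (\<lambda>z. q (snd z))" "q \<in> H 0" by auto
  then show ?case using ext_snd[OF assms graded_add[OF assms, of p 0 q]] by simp
next
  case (Suc d)
  then obtain F p G q where *: "f = (\<lambda>z. fst z * F z + p (snd z))" "F \<in> ext H d" "p \<in> H (Suc d)"
    "g = (\<lambda>z. fst z * G z + q (snd z))" "G \<in> ext H d" "q \<in> H (Suc d)" by auto
  from ext_SucI[OF Suc.IH[OF *(2,5)] graded_add[OF assms *(3,6)]]
  show ?case by (simp add: * algebra_simps)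
qed

lemma ext_snd_mult:
  assumes "graded H" "p \<in> H d"
  shows "g \<in> ext H e \<Longrightarrow> (\<lambda>z. p (snd z) * g z) \<in> ext H (d + e)"
proof (induction e arbitrary: g)
  case 0
  then obtain q where "g = (\<lambda>z. q (snd z))" "q \<in> H 0" by auto
  then show ?case using ext_snd[OF assms(1) graded_mult[OF assms, of q 0]] by simp
next
  case (Suc e)
  then obtain G q where *: "g = (\<lambda>z. fst z * G z + q (snd z))" "G \<in> ext H e" "q \<in> H (Suc e)" by auto
  have "(\<lambda>v. p v * q v) \<in> H (Suc (d + e))" using graded_mult[OF assms *(3)] by simp
  from ext_SucI[OF Suc.IH[OF *(2)] this]
  show ?case by (simp add: * algebra_simps)
qed

lemma ext_mult:
  assumes "graded H"
  shows "f \<in> ext H d \<Longrightarrow> g \<in> ext H e \<Longrightarrow> (\<lambda>z. f z * g z) \<in> ext H (d + e)"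
proof (induction d arbitrary: f)
  case 0
  then obtain p where "f = (\<lambda>z. p (snd z))" "p \<in> H 0" by auto
  then show ?case using ext_snd_mult[OF assms, of p 0 g e] 0 by simp
next
  case (Suc d)
  then obtain F p where *: "f = (\<lambda>z. fst z * F z + p (snd z))" "F \<in> ext H d" "p \<in> H (Suc d)" by auto
  from ext_add[OF assms ext_fst_mult[OF assms Suc.IH[OF *(2) Suc.prems(2)]], of "\<lambda>z. p (snd z) * g z"]
    ext_snd_mult[OF assms *(3) Suc.prems(2)]
  show ?case by (simp add: * algebra_simps)
qed

lemma graded_ext: "graded H \<Longrightarrow> graded (ext H)"
  unfolding graded_def[of "ext H"]
  using zero_in_ext ext_add ext_mult ext_snd[of H _ 0, OF _ graded_const[of H]] by blast

lemma fst_in_ext: "graded H \<Longrightarrow> fst \<in> ext H 1"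
  using ext_fst_mult[of H "\<lambda>_. 1" 0] graded_const[OF graded_ext, of H 1] by simp

text \<open>Substitution: if the last variables are replaced compatibly with the grading, one more
  variable may be replaced by anything of degree 1. With \<open>K\<close> the affine polynomials
  this is dehomogenisation; with \<open>K\<close> the form functions it leads from nested products
  back to \<open>complex ^ 4\<close>.\<close>

lemma ext_comp:
  assumes "graded K" "y \<in> K 1" "\<And>d q. q \<in> H d \<Longrightarrow> (\<lambda>x. q (\<phi> x)) \<in> K d"
  shows "G \<in> ext H d \<Longrightarrow> (\<lambda>x. G (y x, \<phi> x)) \<in> K d"
proof (induction d arbitrary: G)
  case 0
  then show ?case using assms(3) by auto
next
  case (Suc d)
  then obtain F p where *: "G = (\<lambda>z. fst z * F z + p (snd z))" "F \<in> ext H d" "p \<in> H (Suc d)" by auto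
  from graded_mult[OF assms(1,2) Suc.IH[OF *(2)]] graded_add[OF assms(1)] assms(3)[OF *(3)]
  show ?case by (simp add: *)
qed

lemma ext_at_0: "graded H \<Longrightarrow> G \<in> ext H d \<Longrightarrow> (\<lambda>v. G (0, v)) \<in> H d"
  by (cases d) auto

lemma ext_divide:
  assumes "graded H" "G \<in> ext H (Suc d)" "\<And>v. G (0, v) = 0"
  shows "\<exists>F\<in>ext H d. G = (\<lambda>z. fst z * F z)"
proof -
  from assms obtain F p where *: "G = (\<lambda>z. fst z * F z + p (snd z))" "F \<in> ext H d" by auto
  with assms(3) have "p v = 0" for v by simp
  with * show ?thesis by auto
qed

lemma ext_poly: "G \<in> ext H d \<Longrightarrow> \<exists>p. \<forall>x. G (x, v) = poly p x"
proof (induction d arbitrary: G)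
  case 0
  then obtain q where "G = (\<lambda>z. q (snd z))" by auto
  then show ?case by (auto intro!: exI[of _ "[:q v:]"])
next
  case (Suc d)
  then obtain F q where *: "G = (\<lambda>z. fst z * F z + q (snd z))" "F \<in> ext H d" by auto
  from Suc.IH[OF *(2)] obtain p where "\<forall>x. F (x, v) = poly p x" by auto
  then show ?case by (auto simp: * intro!: exI[of _ "pCons (q v) p"])
qed

lemma poly_eq_0_punctured:
  fixes p :: "complex poly"
  assumes "\<And>x. x \<noteq> 0 \<Longrightarrow> poly p x = 0"
  shows "p = 0"
proof (rule ccontr)
  assume "p \<noteq> 0"
  then have "finite (insert 0 {x. poly p x = 0})" by (simp add: poly_roots_finite)
  moreover have "insert 0 {x. poly p x = 0} = UNIV" using assms by auto
  ultimately show False using infinite_UNIV_char_0[where 'a=complex] by simp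
qed

text \<open>A factor \<open>fst\<close> can be divided out of a function only where it is nonzero.
  Along each line in the first variable both sides are polynomials, so agreement there extends to
  0.\<close>

lemma ext_eq_punctured:
  assumes "graded H" "F \<in> ext H d" "G \<in> ext H e" "\<And>x v. x \<noteq> 0 \<Longrightarrow> F (x, v) = G (x, v)"
  shows "F = G"
proof
  fix z :: "complex \<times> 'a"
  obtain x v where z: "z = (x, v)" by (cases z)
  obtain p q where pq: "\<forall>x. F (x, v) = poly p x" "\<forall>x. G (x, v) = poly q x"
    using ext_poly assms(2,3) by metis
  have "p - q = 0" by (rule poly_eq_0_punctured) (metis pq assms(4) poly_diff eq_iff_diff_eq_0)
  then show "F z = G z" using pq z by simp
qed

declare ext.simps [simp del]

text \<open>The scaling \<open>s\<close> is a parameter because on a nested product it acts factor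
  by factor.\<close>

definition homogeneous :: "(complex \<Rightarrow> 'v \<Rightarrow> 'v) \<Rightarrow> (nat \<Rightarrow> ('v \<Rightarrow> complex) set) \<Rightarrow> bool" where
  "homogeneous s H \<longleftrightarrow> (\<forall>d f c v. f \<in> H d \<longrightarrow> f (s c v) = c ^ d * f v)"

lemma homogeneous_ext:
  assumes "homogeneous s H"
  shows "homogeneous (\<lambda>c. map_prod ((*) c) (s c)) (ext H)"
proof -
  have "f (c * x, s c v) = c ^ d * f (x, v)" if "f \<in> ext H d" for d f c x v
    using that
  proof (induction d arbitrary: f)
    case 0
    have "q (s c v) = q v" if "q \<in> H 0" for q
      using assms that unfolding homogeneous_def by (metis mult_1 power_0)
    with 0 show ?case by (auto simp: ext.simps)
  next
    case (Suc d)
    then obtain F q where *: "f = (\<lambda>z. fst z * F z + q (snd z))" "F \<in> ext H d" "q \<in> H (Suc d)"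
      by (auto simp: ext.simps)
    have "q (s c v) = c ^ Suc d * q v" using assms *(3) unfolding homogeneous_def by blast
    with Suc.IH[OF *(2)] show ?case by (simp add: * algebra_simps)
  qed
  then show ?thesis by (auto simp: homogeneous_def)
qed

definition fin_spanned :: "('v \<Rightarrow> complex) set \<Rightarrow> bool" where
  "fin_spanned K \<longleftrightarrow> (\<exists>(n::nat) b. \<forall>g\<in>K. \<exists>c. g = (\<lambda>v. \<Sum>i<n. c i * b i v))"

lemma fin_spanned_ext:
  assumes "\<And>d. fin_spanned (H d)"
  shows "fin_spanned (ext H d)"
proof (induction d)
  case 0
  from assms[of 0] obtain n :: nat and b where nb: "\<forall>g\<in>H 0. \<exists>c. g = (\<lambda>v. \<Sum>i<n. c i * b i v)"
    unfolding fin_spanned_def by blast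
  have "\<exists>c. g = (\<lambda>z. \<Sum>i<n. c i * b i (snd z))" if "g \<in> ext H 0" for g
  proof -
    from that obtain q where q: "g = (\<lambda>z. q (snd z))" "q \<in> H 0" by (auto simp: ext.simps)
    from nb q(2) obtain c where "q = (\<lambda>v. \<Sum>i<n. c i * b i v)" by blast
    with q show ?thesis by auto
  qed
  then show ?case unfolding fin_spanned_def
    by (intro exI[of _ n] exI[of _ "\<lambda>i z. b i (snd z)"] ballI)
next
  case (Suc d)
  from assms[of "Suc d"] obtain n :: nat and b where nb: "\<forall>g\<in>H (Suc d). \<exists>c. g = (\<lambda>v. \<Sum>i<n. c i * b i v)"
    unfolding fin_spanned_def by blast
  from Suc obtain m :: nat and a where ma: "\<forall>g\<in>ext H d. \<exists>c. g = (\<lambda>v. \<Sum>i<m. c i * a i v)"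
    unfolding fin_spanned_def by blast
  define B where "B i z = (if i < m then fst z * a i z else b (i - m) (snd z))" for i and z :: "complex \<times> 'a"
  have "\<exists>c. g = (\<lambda>z. \<Sum>i<m+n. c i * B i z)" if "g \<in> ext H (Suc d)" for g
  proof -
    from that obtain F q where *: "g = (\<lambda>z. fst z * F z + q (snd z))" "F \<in> ext H d" "q \<in> H (Suc d)"
      by (auto simp: ext.simps)
    from nb *(3) obtain c where c: "q = (\<lambda>v. \<Sum>i<n. c i * b i v)" by blast
    from ma *(2) obtain e where e: "F = (\<lambda>v. \<Sum>i<m. e i * a i v)" by blast
    define C where "C i = (if i < m then e i else c (i - m))" for i
    have "(\<Sum>i<m+n. C i * B i z) = g z" for z
    proof -
      have "(\<Sum>i<m+n. C i * B i z) = (\<Sum>i<m. C i * B i z) + (\<Sum>i<n. C (m+i) * B (m+i) z)"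
        by (induction n) (auto simp: add.assoc)
      also have "\<dots> = g z" by (simp add: * c e C_def B_def sum_distrib_left algebra_simps)
      finally show ?thesis .
    qed
    then show ?thesis by (intro exI[of _ C]) auto
  qed
  then show ?case unfolding fin_spanned_def by (intro exI[of _ "m+n"] exI[of _ B] ballI)
qed

text \<open>The coefficients of \<open>n + 1\<close> members with respect to \<open>n\<close>
  spanning functions give \<open>n\<close> equations in \<open>n + 1\<close> unknowns. As
  \<open>n\<close> does not depend on \<open>g\<close>, the first members of an infinite sequence
  may be taken.\<close>

lemma fin_spanned_dependent:
  assumes "fin_spanned K"
  shows "\<exists>n::nat. \<forall>g. (\<forall>i\<le>n. g i \<in> K) \<longrightarrow> (\<exists>c. (\<exists>i\<le>n. c i \<noteq> 0) \<and> (\<forall>v. (\<Sum>i\<le>n. c i * g i v) = 0))"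
proof -
  from assms obtain n :: nat and b where nb: "\<forall>g\<in>K. \<exists>c. g = (\<lambda>v. \<Sum>i<n. c i * b i v)"
    unfolding fin_spanned_def by blast
  have "\<exists>c. (\<exists>i\<le>n. c i \<noteq> 0) \<and> (\<forall>v. (\<Sum>i\<le>n. c i * g i v) = 0)" if "\<forall>i\<le>n. g i \<in> K" for g
  proof -
    from that nb have "\<forall>i\<in>{..n}. \<exists>c. g i = (\<lambda>v. \<Sum>j<n. c j * b j v)" by auto
    then obtain M where M: "\<And>i. i \<le> n \<Longrightarrow> g i = (\<lambda>v. \<Sum>j<n. M i j * b j v)" by (metis atMost_iff)
    from nontrivial_solution[of "{..<n}" "{..n}" M] obtain x where
      x: "\<exists>i\<le>n. x i \<noteq> 0" "\<forall>j<n. (\<Sum>i\<le>n. x i * M i j) = 0" by auto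
    have "(\<Sum>i\<le>n. x i * g i v) = 0" for v
    proof -
      have "(\<Sum>i\<le>n. x i * g i v) = (\<Sum>i\<le>n. \<Sum>j<n. x i * M i j * b j v)"
        by (rule sum.cong) (auto simp: M sum_distrib_left mult.assoc)
      also have "\<dots> = (\<Sum>j<n. (\<Sum>i\<le>n. x i * M i j) * b j v)"
        by (subst sum.swap) (simp add: sum_distrib_right)
      also have "\<dots> = 0" using x(2) by simp
      finally show ?thesis .
    qed
    with x(1) show ?thesis by blast
  qed
  then show ?thesis by (intro exI[of _ n]) simp
qed


section \<open>Binary cubics\<close>

definition forms1 :: "nat \<Rightarrow> (complex \<Rightarrow> complex) set" where
  "forms1 d = {\<lambda>t. c * t ^ d | c. True}"

abbreviation "forms2 \<equiv> ext forms1"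
abbreviation "forms3 \<equiv> ext forms2"
abbreviation "forms4 \<equiv> ext forms3"

lemma graded_forms1: "graded forms1"
proof -
  have "(\<lambda>v. f v + g v) \<in> forms1 d" if "f \<in> forms1 d" "g \<in> forms1 d" for f g d
  proof -
    from that obtain a b where "f = (\<lambda>t. a * t ^ d)" "g = (\<lambda>t. b * t ^ d)" by (auto simp: forms1_def)
    then have "(\<lambda>v. f v + g v) = (\<lambda>t. (a + b) * t ^ d)" by (simp add: algebra_simps)
    then show ?thesis by (auto simp: forms1_def)
  qed
  moreover have "(\<lambda>v. f v * g v) \<in> forms1 (d + e)" if "f \<in> forms1 d" "g \<in> forms1 e" for f g d e
  proof -
    from that obtain a b where "f = (\<lambda>t. a * t ^ d)" "g = (\<lambda>t. b * t ^ e)" by (auto simp: forms1_def)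
    then have "(\<lambda>v. f v * g v) = (\<lambda>t. (a * b) * t ^ (d + e))" by (simp add: algebra_simps power_add)
    then show ?thesis by (auto simp: forms1_def)
  qed
  moreover have "(\<lambda>_. 0) \<in> forms1 d" for d
    unfolding forms1_def by (auto intro!: exI[of _ 0])
  moreover have "(\<lambda>_. c) \<in> forms1 0" for c
    unfolding forms1_def by auto
  ultimately show ?thesis unfolding graded_def by blast
qed

lemmas graded_forms2 = graded_ext[OF graded_forms1]
lemmas graded_forms3 = graded_ext[OF graded_forms2]
lemmas graded_forms4 = graded_ext[OF graded_forms3]

lemma homogeneous_forms1: "homogeneous (*) forms1"
  by (auto simp: homogeneous_def forms1_def power_mult_distrib)

lemmas homogeneous_forms2 = homogeneous_ext[OF homogeneous_forms1]
lemmas homogeneous_forms3 = homogeneous_ext[OF homogeneous_forms2]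

lemma fin_spanned_forms1: "fin_spanned (forms1 d)"
  unfolding fin_spanned_def forms1_def
  by (rule exI[of _ 1], rule exI[of _ "\<lambda>_ t. t ^ d"]) (auto intro: exI[of _ "\<lambda>_. _"])

lemma fin_spanned_forms3: "fin_spanned (forms3 d)"
  by (intro fin_spanned_ext fin_spanned_forms1)

text \<open>Dehomogenisation does not lose the point at infinity: the value at \<open>(1, 0)\<close>
  survives as the coefficient in degree \<open>d\<close>, which may exceed the degree of
  \<open>p\<close>.\<close>

lemma binary_poly:
  "F \<in> forms2 d \<Longrightarrow> \<exists>p. degree p \<le> d \<and> (\<forall>s. F (s, 1) = poly p s) \<and> F (1, 0) = coeff p d"
proof (induction d arbitrary: F)
  case 0
  then obtain c where "F = (\<lambda>z. c)" by (auto simp: forms1_def ext.simps)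
  then show ?case by (auto intro!: exI[of _ "[:c:]"])
next
  case (Suc d)
  then obtain G q where Gq: "F = (\<lambda>z. fst z * G z + q (snd z))" "G \<in> forms2 d" "q \<in> forms1 (Suc d)"
    by (auto simp: ext.simps)
  from Gq(3) obtain c where "q = (\<lambda>t. c * t ^ Suc d)" unfolding forms1_def by blast
  with Gq have *: "F = (\<lambda>z. fst z * G z + c * snd z ^ Suc d)" "G \<in> forms2 d" by simp_all
  from Suc.IH[OF *(2)] obtain p where "degree p \<le> d" "\<forall>s. G (s, 1) = poly p s" "G (1, 0) = coeff p d"
    by auto
  with * show ?case by (auto intro!: exI[of _ "pCons c p"])
qed

lemma poly_binary:
  "degree p \<le> d \<Longrightarrow> \<exists>F\<in>forms2 d. \<forall>s. F (s, 1) = poly p s"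
proof (induction d arbitrary: p)
  case 0
  then obtain c where "p = [:c:]" by (metis degree_eq_zeroE le_zero_eq)
  then show ?case by (intro bexI[OF _ graded_const[OF graded_forms2, of c]]) auto
next
  case (Suc d)
  obtain a q where p: "p = pCons a q" by (cases p)
  have "degree q \<le> d" using Suc.prems by (auto simp: p split: if_splits)
  from Suc.IH[OF this] obtain F where F: "F \<in> forms2 d" "\<forall>s. F (s, 1) = poly q s" by auto
  have "(\<lambda>t. a * t ^ Suc d) \<in> forms1 (Suc d)" by (auto simp: forms1_def)
  from ext_SucI[of F forms1, OF F(1) this] show ?case
    by (rule bexI[rotated]) (use F in \<open>auto simp: p\<close>)
qed

lemma binary_eqI:
  assumes "F \<in> forms2 d" "G \<in> forms2 d" "\<And>s. F (s, 1) = G (s, 1)"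
  shows "F = G"
proof -
  define D where "D z = F z - G z" for z
  have D: "D \<in> forms2 d" unfolding D_def using graded_diff[OF graded_forms2 assms(1,2)] .
  from binary_poly[OF D] obtain p where p: "\<forall>s. D (s, 1) = poly p s" "D (1, 0) = coeff p d" by auto
  have "p = 0" using p(1) assms(3) by (intro poly_eq_0_punctured) (simp add: D_def)
  have scale: "D (c * s, c * t) = c ^ d * D (s, t)" for c s t
    using homogeneous_forms2 D unfolding homogeneous_def by fastforce
  have "D (s, t) = 0" for s t
  proof (cases "t = 0")
    case True
    then show ?thesis using scale[of s 1 0] p(2) \<open>p = 0\<close> by simp
  next
    case False
    then show ?thesis using scale[of t "s / t" 1] p(1) \<open>p = 0\<close> by simp
  qed
  then show ?thesis by (auto simp: D_def fun_eq_iff)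
qed

lemma complex_poly_bezout:
  fixes p q :: "complex poly"
  assumes "p \<noteq> 0" "\<And>x. poly p x = 0 \<Longrightarrow> poly q x \<noteq> 0"
  shows "coprime p q"
proof (rule coprimeI)
  fix r assume r: "r dvd p" "r dvd q"
  then have "r \<noteq> 0" using assms(1) by auto
  have "poly r x \<noteq> 0" for x
  proof
    assume "poly r x = 0"
    then have "poly p x = 0" "poly q x = 0" using r by (auto elim!: dvdE)
    then show False using assms(2) by blast
  qed
  then have "degree r = 0" using Fundamental_Theorem_Algebra.fundamental_theorem_of_algebra[of r] constant_degree[of r] by auto
  then show "is_unit r" using \<open>r \<noteq> 0\<close> is_unit_iff_degree by blast
qed

text \<open>Two binary cubics without common zero on the projective line. Infinity is taken care of
  by \<open>q1\<close> alone, so that its polynomial has degree exactly 3 and division by it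
  controls degrees.\<close>

locale coprime_binary_cubics =
  fixes q1 q2 :: "complex \<times> complex \<Rightarrow> complex"
  assumes q1: "q1 \<in> forms2 3" and q2: "q2 \<in> forms2 3"
    and q1_inf: "q1 (1, 0) \<noteq> 0" and no_common_zero: "\<And>s. q1 (s, 1) = 0 \<Longrightarrow> q2 (s, 1) \<noteq> 0"
begin

lemma polys:
  obtains p1 p2 where "degree p1 = 3" "degree p2 \<le> 3" "coprime p1 p2"
    "\<And>s. q1 (s, 1) = poly p1 s" "\<And>s. q2 (s, 1) = poly p2 s"
proof -
  from binary_poly[OF q1] obtain p1 where p1: "degree p1 \<le> 3" "\<forall>s. q1 (s, 1) = poly p1 s"
    "q1 (1, 0) = coeff p1 3" by auto
  from binary_poly[OF q2] obtain p2 where p2: "degree p2 \<le> 3" "\<forall>s. q2 (s, 1) = poly p2 s" by auto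
  have "degree p1 = 3" using p1 q1_inf by (metis le_antisym le_degree)
  moreover have "coprime p1 p2"
    using p1 p2 no_common_zero q1_inf by (intro complex_poly_bezout) auto
  ultimately show thesis using that p1 p2 by blast
qed

text \<open>The quotient by two coprime binary cubics is zero above degree
  \<open>(3 - 1) + (3 - 1) = 4\<close>, whence \<open>k + 3 \<ge> 5\<close>. A Bezout identity gives
  cofactors of unknown degree, which have to be normalised.\<close>

lemma generate_binary:
  assumes "g \<in> forms2 (k + 3)" "k \<ge> 2"
  shows "\<exists>a\<in>forms2 k. \<exists>b\<in>forms2 k. g = (\<lambda>v. q1 v * a v + q2 v * b v)"
proof -
  obtain p1 p2 where p: "degree p1 = 3" "degree p2 \<le> 3" "coprime p1 p2"
    "\<And>s. q1 (s, 1) = poly p1 s" "\<And>s. q2 (s, 1) = poly p2 s" using polys by blast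
  from binary_poly[OF assms(1)] obtain r where r: "degree r \<le> k + 3" "\<forall>s. g (s, 1) = poly r s" by auto
  obtain x y where xy: "x * p1 + y * p2 = 1"
    using p(3) by (metis bezout_coefficients_fst_snd coprime_iff_gcd_eq_1)
  \<comment> \<open>The cofactor of \<open>p2\<close> is reduced modulo \<open>p1\<close> to degree
    at most 2, and \<open>A\<close> absorbs the quotient. The bound on \<open>A\<close> then follows
    from \<open>A * p1 = r - B * p2\<close>.\<close>
  define B where "B = (r * y) mod p1"
  define A where "A = r * x + (r * y) div p1 * p2"
  have eq: "A * p1 + B * p2 = r"
  proof -
    have "A * p1 + B * p2 = r * x * p1 + ((r * y) div p1 * p1 + (r * y) mod p1) * p2"
      unfolding A_def B_def by algebra
    also have "\<dots> = r * (x * p1 + y * p2)" by (simp only: div_mult_mod_eq) (simp add: algebra_simps)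
    finally show ?thesis by (simp add: xy)
  qed
  have "p1 \<noteq> 0" using p(1) by auto
  then have B: "degree B \<le> 2" using degree_mod_less[of p1 "r * y"] p(1) by (auto simp: B_def)
  have "degree (A * p1) \<le> k + 3"
  proof -
    have "A * p1 = r - B * p2" using eq by (simp add: algebra_simps)
    moreover have "degree (B * p2) \<le> k + 3" using degree_mult_le[of B p2] B p(2) assms(2) by linarith
    ultimately show ?thesis using r(1) by (simp add: degree_diff_le)
  qed
  then have A: "degree A \<le> k" using p(1) \<open>p1 \<noteq> 0\<close> by (cases "A = 0") (auto simp: degree_mult_eq)
  from poly_binary[OF A] obtain a where a: "a \<in> forms2 k" "\<forall>s. a (s, 1) = poly A s" by auto
  from B assms(2) have "degree B \<le> k" by simp
  from poly_binary[OF this] obtain b where b: "b \<in> forms2 k" "\<forall>s. b (s, 1) = poly B s" by auto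
  have "(\<lambda>v. q1 v * a v) \<in> forms2 (k + 3)" "(\<lambda>v. q2 v * b v) \<in> forms2 (k + 3)"
    using graded_mult[OF graded_forms2 q1 a(1)] graded_mult[OF graded_forms2 q2 b(1)]
    by (simp_all add: add.commute)
  from graded_add[OF graded_forms2 this]
  have "g = (\<lambda>v. q1 v * a v + q2 v * b v)"
  proof (rule binary_eqI[OF assms(1)])
    fix s
    have "g (s, 1) = poly (A * p1 + B * p2) s" using r(2) eq by simp
    then show "g (s, 1) = q1 (s, 1) * a (s, 1) + q2 (s, 1) * b (s, 1)"
      using a b p by (simp add: mult.commute)
  qed
  with a b show ?thesis by blast
qed

text \<open>A coprime pair has only the Koszul syzygies, since \<open>p1\<close> divides
  \<open>p2 * B\<close> and therefore \<open>B\<close>.\<close>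

lemma syzygy_binary:
  assumes "a \<in> forms2 (k + 3)" "b \<in> forms2 (k + 3)" "\<And>v. q1 v * a v + q2 v * b v = 0"
  shows "\<exists>e\<in>forms2 k. a = (\<lambda>v. e v * q2 v) \<and> b = (\<lambda>v. - 1 * (e v * q1 v))"
proof -
  obtain p1 p2 where p: "degree p1 = 3" "degree p2 \<le> 3" "coprime p1 p2"
    "\<And>s. q1 (s, 1) = poly p1 s" "\<And>s. q2 (s, 1) = poly p2 s" using polys by blast
  from binary_poly[OF assms(1)] obtain A where A: "\<forall>s. a (s, 1) = poly A s" by auto
  from binary_poly[OF assms(2)] obtain B where B: "degree B \<le> k + 3" "\<forall>s. b (s, 1) = poly B s" by auto
  have "p1 \<noteq> 0" using p(1) by auto
  have eq: "p1 * A + p2 * B = 0"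
  proof (rule poly_eq_0_punctured)
    fix s :: complex
    have "poly (p1 * A + p2 * B) s = q1 (s,1) * a (s,1) + q2 (s,1) * b (s,1)" using A B p by simp
    then show "poly (p1 * A + p2 * B) s = 0" using assms(3) by simp
  qed
  then have "p2 * B = p1 * (- A)" by (simp add: add_eq_0_iff)
  then have "p1 dvd p2 * B" by simp
  then have "p1 dvd B" using p(3) coprime_dvd_mult_right_iff by blast
  then obtain E' where "B = p1 * E'" by auto
  define E where "E = - E'"
  have BE: "B = - (E * p1)" using \<open>B = p1 * E'\<close> by (simp add: E_def)
  have "p1 * A = p1 * (E * p2)" using eq BE by (simp add: algebra_simps)
  then have AE: "A = E * p2" using \<open>p1 \<noteq> 0\<close> by simp
  have "degree E \<le> k"
    using B(1) BE p(1) \<open>p1 \<noteq> 0\<close> by (cases "E = 0") (auto simp: degree_mult_eq)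
  from poly_binary[OF this] obtain e where e: "e \<in> forms2 k" "\<forall>s. e (s, 1) = poly E s" by auto
  have "a = (\<lambda>v. e v * q2 v)"
    by (rule binary_eqI[OF assms(1) graded_mult[OF graded_forms2 e(1) q2]]) (simp add: A AE e p)
  moreover have "b = (\<lambda>v. - 1 * (e v * q1 v))"
    by (rule binary_eqI[OF assms(2) graded_scale[OF graded_forms2 graded_mult[OF graded_forms2 e(1) q1]]])
      (simp add: B BE e p)
  ultimately show ?thesis using e by blast
qed

end


section \<open>The affine plane\<close>

inductive_set affine_poly :: "(complex \<times> complex \<Rightarrow> complex) set" where
  affine_const: "(\<lambda>_. c) \<in> affine_poly"
| affine_fst: "fst \<in> affine_poly"
| affine_snd: "snd \<in> affine_poly"
| affine_add: "f \<in> affine_poly \<Longrightarrow> g \<in> affine_poly \<Longrightarrow> (\<lambda>v. f v + g v) \<in> affine_poly"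
| affine_mult: "f \<in> affine_poly \<Longrightarrow> g \<in> affine_poly \<Longrightarrow> (\<lambda>v. f v * g v) \<in> affine_poly"

lemma graded_affine_poly: "graded (\<lambda>_. affine_poly)"
  unfolding graded_def by (auto intro: affine_poly.intros)

lemma forms3_affine:
  assumes "G \<in> forms3 d"
  shows "(\<lambda>v. G (1, v)) \<in> affine_poly"
proof -
  have 1: "(\<lambda>v. q (snd v)) \<in> affine_poly" if "q \<in> forms1 e" for q e
  proof -
    from that obtain c where "q = (\<lambda>t. c * t ^ e)" by (auto simp: forms1_def)
    then show ?thesis
      using graded_scale[OF graded_affine_poly graded_power[OF graded_affine_poly affine_snd, of e], of c] by simp
  qed
  have 2: "q \<in> affine_poly" if "q \<in> forms2 e" for q e
    using ext_comp[OF graded_affine_poly affine_fst, of forms1 snd, OF 1 that] by simp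
  show ?thesis
    using ext_comp[OF graded_affine_poly affine_const, of forms2 "\<lambda>v. v", OF _ assms] 2 by simp
qed

lemma fst_snd_in_forms2: "fst \<in> forms2 1" "snd \<in> forms2 1"
proof -
  show "fst \<in> forms2 1" by (rule fst_in_ext[OF graded_forms1])
  have "(\<lambda>t. t) \<in> forms1 1" unfolding forms1_def by (auto intro!: exI[of _ 1])
  from ext_snd[OF graded_forms1 this] show "snd \<in> forms2 1" by simp
qed

text \<open>Homogenisation. The degree is existential because summands are first padded with powers
  of the first variable to a common degree.\<close>

lemma affine_forms3:
  assumes "r \<in> affine_poly"
  shows "\<exists>d. \<exists>G\<in>forms3 d. r = (\<lambda>v. G (1, v))"
  using assms
proof induction
  case (affine_const c)
  then show ?case by (intro exI[of _ 0] bexI[OF _ graded_const[OF graded_forms3, of c]]) simp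
next
  case affine_fst
  show ?case
    by (intro exI[of _ 1] bexI[OF _ ext_snd[OF graded_forms2 fst_snd_in_forms2(1)]]) simp
next
  case affine_snd
  show ?case
    by (intro exI[of _ 1] bexI[OF _ ext_snd[OF graded_forms2 fst_snd_in_forms2(2)]]) simp
next
  case (affine_add f g)
  then obtain d F e G where *: "F \<in> forms3 d" "f = (\<lambda>v. F (1, v))" "G \<in> forms3 e" "g = (\<lambda>v. G (1, v))"
    by blast
  have "(\<lambda>z. fst z ^ e * F z) \<in> forms3 (d + e)" "(\<lambda>z. fst z ^ d * G z) \<in> forms3 (d + e)"
    using graded_mult[OF graded_forms3 graded_power[OF graded_forms3 fst_in_ext[OF graded_forms2]] *(1), of e]
      graded_mult[OF graded_forms3 graded_power[OF graded_forms3 fst_in_ext[OF graded_forms2]] *(3), of d]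
    by (simp_all add: add.commute)
  from graded_add[OF graded_forms3 this] show ?case
    by (intro exI[of _ "d + e"], elim bexI[rotated]) (simp add: *)
next
  case (affine_mult f g)
  then obtain d F e G where *: "F \<in> forms3 d" "f = (\<lambda>v. F (1, v))" "G \<in> forms3 e" "g = (\<lambda>v. G (1, v))"
    by blast
  from graded_mult[OF graded_forms3 *(1,3)] show ?case
    by (intro exI[of _ "d + e"], elim bexI[rotated]) (simp add: *)
qed

lemma product_remainder:
  fixes x y :: "'a::comm_ring"
  assumes "f = f0 + x * h1 + y * h2" "g = g0 + x * k1 + y * k2"
  shows "f * g = f0 * g0 + x * (h1 * g + f0 * k1) + y * (h2 * g + f0 * k2)"
proof -
  have "f * g = f0 * g + x * (h1 * g) + y * (h2 * g)" by (subst assms(1)) (simp add: algebra_simps)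
  also have "f0 * g = f0 * g0 + x * (f0 * k1) + y * (f0 * k2)" by (subst assms(2)) (simp add: algebra_simps)
  finally show ?thesis by (simp add: algebra_simps)
qed

text \<open>A Taylor expansion with polynomial remainders: \<open>r\<close> is congruent to its
  value at \<open>(a, b)\<close> modulo the maximal ideal of that point.\<close>

lemma affine_remainder:
  assumes "r \<in> affine_poly"
  shows "\<exists>h1\<in>affine_poly. \<exists>h2\<in>affine_poly.
    \<forall>v. r v = r (a, b) + (fst v - a) * h1 v + (snd v - b) * h2 v"
  using assms
proof induction
  case (affine_const c)
  show ?case by (intro bexI[OF _ affine_poly.affine_const[of 0]]) auto
next
  case affine_fst
  show ?case by (intro bexI[OF _ affine_poly.affine_const[of 1]] bexI[OF _ affine_poly.affine_const[of 0]]) auto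
next
  case affine_snd
  show ?case by (rule bexI[OF _ affine_poly.affine_const[of 0]], rule bexI[OF _ affine_poly.affine_const[of 1]]) auto
next
  case (affine_add f g)
  then obtain h1 h2 k1 k2 where *: "h1 \<in> affine_poly" "h2 \<in> affine_poly" "k1 \<in> affine_poly" "k2 \<in> affine_poly"
    "\<forall>v. f v = f (a, b) + (fst v - a) * h1 v + (snd v - b) * h2 v"
    "\<forall>v. g v = g (a, b) + (fst v - a) * k1 v + (snd v - b) * k2 v" by blast
  have "f v + g v = f (a, b) + g (a, b) + (fst v - a) * (h1 v + k1 v) + (snd v - b) * (h2 v + k2 v)" for v
    by (subst *(5)[rule_format, of v], subst *(6)[rule_format, of v]) (simp add: algebra_simps)
  then show ?case
    by (intro bexI[OF _ affine_poly.affine_add[OF *(1,3)]] bexI[OF _ affine_poly.affine_add[OF *(2,4)]]) blast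
next
  case (affine_mult f g)
  then obtain h1 h2 k1 k2 where *: "h1 \<in> affine_poly" "h2 \<in> affine_poly" "k1 \<in> affine_poly" "k2 \<in> affine_poly"
    "\<forall>v. f v = f (a, b) + (fst v - a) * h1 v + (snd v - b) * h2 v"
    "\<forall>v. g v = g (a, b) + (fst v - a) * k1 v + (snd v - b) * k2 v" by blast
  have "\<forall>v. f v * g v = f (a, b) * g (a, b) + (fst v - a) * (h1 v * g v + f (a, b) * k1 v)
        + (snd v - b) * (h2 v * g v + f (a, b) * k2 v)"
    by (rule allI, rule product_remainder[OF *(5,6)[rule_format]])
  moreover have "(\<lambda>v. h v * g v + f (a, b) * k v) \<in> affine_poly"
    if "h \<in> affine_poly" "k \<in> affine_poly" for h k
    by (intro affine_poly.affine_add affine_poly.affine_mult affine_poly.affine_const that affine_mult.hyps)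
  ultimately show ?case
    using *(1-4) by (intro bexI[where x = "\<lambda>v. h1 v * g v + f (a, b) * k1 v"]
        bexI[where x = "\<lambda>v. h2 v * g v + f (a, b) * k2 v"])
qed

section \<open>Ideals and units in the affine plane\<close>

definition affine_ideal :: "(complex \<times> complex \<Rightarrow> complex) set \<Rightarrow> bool" where
  "affine_ideal I \<longleftrightarrow> (\<lambda>_. 0) \<in> I \<and> (\<forall>f\<in>I. \<forall>g\<in>I. (\<lambda>v. f v + g v) \<in> I) \<and>
     (\<forall>f\<in>I. \<forall>r\<in>affine_poly. (\<lambda>v. f v * r v) \<in> I)"

lemma affine_ideal_zero: "affine_ideal I \<Longrightarrow> (\<lambda>_. 0) \<in> I"
  and affine_ideal_add: "affine_ideal I \<Longrightarrow> f \<in> I \<Longrightarrow> g \<in> I \<Longrightarrow> (\<lambda>v. f v + g v) \<in> I"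
  and affine_ideal_mult: "affine_ideal I \<Longrightarrow> f \<in> I \<Longrightarrow> r \<in> affine_poly \<Longrightarrow> (\<lambda>v. f v * r v) \<in> I"
  by (auto simp: affine_ideal_def)

definition unit_mod where
  "unit_mod I u \<longleftrightarrow> (\<exists>h\<in>affine_poly. (\<lambda>v. 1 - u v * h v) \<in> I)"

lemma unit_mod_mult:
  assumes "affine_ideal I" "f \<in> affine_poly" "unit_mod I f" "unit_mod I g"
  shows "unit_mod I (\<lambda>v. f v * g v)"
proof -
  from assms obtain h k where *: "h \<in> affine_poly" "(\<lambda>v. 1 - f v * h v) \<in> I"
    "k \<in> affine_poly" "(\<lambda>v. 1 - g v * k v) \<in> I" by (auto simp: unit_mod_def)
  have "(\<lambda>v. (1 - g v * k v) * (f v * h v)) \<in> I"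
    by (rule affine_ideal_mult[OF assms(1) *(4) affine_mult[OF assms(2) *(1)]])
  from affine_ideal_add[OF assms(1) *(2) this]
  have "(\<lambda>v. (1 - f v * h v) + (1 - g v * k v) * (f v * h v)) \<in> I" .
  moreover have "(1 - f v * h v) + (1 - g v * k v) * (f v * h v) = 1 - f v * g v * (h v * k v)" for v
    by algebra
  ultimately show ?thesis unfolding unit_mod_def
    by (intro bexI[OF _ affine_mult[OF *(1,3)]]) simp
qed

lemma one_in_ideal:
  assumes "affine_ideal I" "f \<in> I" "unit_mod I f"
  shows "(\<lambda>_. 1) \<in> I"
proof -
  from assms obtain h where *: "h \<in> affine_poly" "(\<lambda>v. 1 - f v * h v) \<in> I" by (auto simp: unit_mod_def)
  from affine_ideal_add[OF assms(1) *(2) affine_ideal_mult[OF assms(1,2) *(1)]]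
  show ?thesis by simp
qed

lemma affine_minus_const: "x \<in> affine_poly \<Longrightarrow> (\<lambda>v. x v - c) \<in> affine_poly"
  using affine_add[OF _ affine_const, of x "-c"] by simp

text \<open>Over the complex numbers \<open>p\<close> splits into linear factors. Each becomes a
  unit by hypothesis, and products of units are units.\<close>

lemma unit_mod_poly:
  assumes "affine_ideal I" "x \<in> affine_poly" "\<And>c. unit_mod I (\<lambda>v. x v - c)" "p \<noteq> 0"
  shows "unit_mod I (\<lambda>v. poly p (x v))"
  using assms(4)
proof (induction "degree p" arbitrary: p)
  case 0
  then obtain c where c: "p = [:c:]" "c \<noteq> 0" by (metis degree_eq_zeroE pCons_0_0)
  have "(\<lambda>v. 1 - poly p (x v) * (1 / c)) \<in> I" using assms(1) c by (simp add: affine_ideal_def)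
  then show ?case unfolding unit_mod_def by (intro bexI[OF _ affine_const[of "1 / c"]])
next
  case (Suc n)
  then have "\<not> constant (poly p)" by (simp add: constant_degree)
  from Fundamental_Theorem_Algebra.fundamental_theorem_of_algebra[OF this] obtain c where "poly p c = 0" by auto
  then obtain q where q: "p = [:- c, 1:] * q" unfolding poly_eq_0_iff_dvd by auto
  with Suc have "q \<noteq> 0" by auto
  then have "degree p = Suc (degree q)" unfolding q by (subst degree_mult_eq) auto
  with Suc.hyps(2) have "n = degree q" by simp
  from Suc.hyps(1)[OF this \<open>q \<noteq> 0\<close>]
  have "unit_mod I (\<lambda>v. (x v - c) * poly q (x v))"
    using unit_mod_mult[OF assms(1) affine_minus_const[OF assms(2)] assms(3)] by blast
  moreover have "poly p y = (y - c) * poly q y" for y by (simp add: q algebra_simps)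
  ultimately show ?case by simp
qed

text \<open>
  The weak Nullstellensatz in the plane for ideals containing a polynomial in each coordinate:
  by the hypothesis on values, each \<open>snd - b\<close> is a unit modulo \<open>I + (fst - a)\<close>, so
  \<open>q (snd)\<close> is one too; hence each \<open>fst - a\<close> is a unit modulo \<open>I\<close>, and so is \<open>p (fst)\<close>.
\<close>

lemma affine_nullstellensatz:
  assumes "affine_ideal I" and pq: "p \<noteq> 0" "(\<lambda>v. poly p (fst v)) \<in> I" "q \<noteq> 0" "(\<lambda>v. poly q (snd v)) \<in> I"
    and value_nonzero: "\<And>a b. \<exists>f\<in>I \<inter> affine_poly. f (a, b) \<noteq> 0"
  shows "(\<lambda>_. 1) \<in> I"
proof -
  have "unit_mod I (\<lambda>v. fst v - a)" for a
  proof -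
    define I' where "I' = {\<lambda>v. f v + (fst v - a) * h v | f h. f \<in> I \<and> h \<in> affine_poly}"
    have I'I: "(\<lambda>v. f v + (fst v - a) * h v) \<in> I'" if "f \<in> I" "h \<in> affine_poly" for f h
      using that unfolding I'_def by blast
    have "affine_ideal I'"
      unfolding affine_ideal_def
    proof (intro conjI ballI)
      show "(\<lambda>_. 0) \<in> I'"
        using I'I[of "\<lambda>_. 0" "\<lambda>_. 0"] assms(1) affine_const[of 0] by (simp add: affine_ideal_def)
    next
      fix f g assume "f \<in> I'" "g \<in> I'"
      then obtain f1 h1 f2 h2 where *: "f = (\<lambda>v. f1 v + (fst v - a) * h1 v)" "f1 \<in> I" "h1 \<in> affine_poly"
        "g = (\<lambda>v. f2 v + (fst v - a) * h2 v)" "f2 \<in> I" "h2 \<in> affine_poly" unfolding I'_def by blast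
      have "(\<lambda>v. f1 v + f2 v) \<in> I" using assms(1) * by (simp add: affine_ideal_def)
      from I'I[OF this affine_add[OF *(3,6)]] show "(\<lambda>v. f v + g v) \<in> I'"
        by (simp add: * algebra_simps)
    next
      fix f r assume "f \<in> I'" and r: "r \<in> affine_poly"
      then obtain f1 h1 where *: "f = (\<lambda>v. f1 v + (fst v - a) * h1 v)" "f1 \<in> I" "h1 \<in> affine_poly"
        unfolding I'_def by blast
      have "(\<lambda>v. f1 v * r v) \<in> I" using assms(1) * r by (simp add: affine_ideal_def)
      from I'I[OF this affine_mult[OF *(3) r]] show "(\<lambda>v. f v * r v) \<in> I'"
        by (simp add: * algebra_simps)
    qed
    moreover have "I \<subseteq> I'"
      using I'I[OF _ affine_const[of 0]] by auto
    moreover have "unit_mod I' (\<lambda>v. snd v - b)" for b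
    proof -
      from value_nonzero obtain f where f: "f \<in> I" "f \<in> affine_poly" "f (a, b) \<noteq> 0" by blast
      \<comment> \<open>Divided by the nonzero value \<open>f (a, b)\<close>, the expansion exhibits
        1 as a multiple of \<open>snd - b\<close> modulo \<open>I'\<close>, which absorbs
        \<open>f\<close> and the term with \<open>fst - a\<close>.\<close>
      from affine_remainder[OF f(2), of a b] obtain h1 h2 where h: "h1 \<in> affine_poly" "h2 \<in> affine_poly"
        "\<And>v. f v = f (a, b) + (fst v - a) * h1 v + (snd v - b) * h2 v" by blast
      define c where "c = 1 / f (a, b)"
      have c: "c * f (a, b) = 1" using f(3) by (simp add: c_def)
      have "(\<lambda>v. f v * c) \<in> I" by (rule affine_ideal_mult[OF assms(1) f(1) affine_const])
      from I'I[OF this affine_mult[OF affine_const[of "-c"] h(1)]]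
      have "(\<lambda>v. f v * c + (fst v - a) * (- c * h1 v)) \<in> I'" .
      moreover have "f v * c + (fst v - a) * (- c * h1 v) = 1 - (snd v - b) * (- c * h2 v)" for v
      proof -
        have "f v * c + (fst v - a) * (- c * h1 v) = c * f (a, b) - (snd v - b) * (- c * h2 v)"
          by (subst h(3)[of v]) (simp add: algebra_simps)
        then show ?thesis by (simp add: c)
      qed
      ultimately show ?thesis unfolding unit_mod_def
        by (intro bexI[OF _ affine_mult[OF affine_const[of "-c"] h(2)]]) simp
    qed
    ultimately have "(\<lambda>_. 1) \<in> I'"
      using unit_mod_poly[OF _ affine_snd, of I' q] one_in_ideal[of I' "\<lambda>v. poly q (snd v)"] pq by blast
    then obtain f h where fh: "(\<lambda>_. 1) = (\<lambda>v. f v + (fst v - a) * h v)" "f \<in> I" "h \<in> affine_poly"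
      unfolding I'_def by blast
    have "f = (\<lambda>v. 1 - (fst v - a) * h v)"
    proof
      fix v
      from fun_cong[OF fh(1), of v] show "f v = 1 - (fst v - a) * h v" by (simp only: eq_diff_eq)
    qed
    with fh show ?thesis unfolding unit_mod_def by (intro bexI[of _ h]) simp_all
  qed
  from unit_mod_poly[OF assms(1) affine_fst this pq(1)] show ?thesis
    by (rule one_in_ideal[OF assms(1) pq(2)])
qed


section \<open>Base point free systems of ternary cubics\<close>

text \<open>The part of degree \<open>e + 3\<close> of the ideal generated by \<open>V\<close>; the
  index is the degree of the cofactors.\<close>

inductive_set cubic_multiples :: "((complex \<times> complex \<times> complex) \<Rightarrow> complex) set \<Rightarrow> nat \<Rightarrow> ((complex \<times> complex \<times> complex) \<Rightarrow> complex) set"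
  for V e where
  zero: "(\<lambda>_. 0) \<in> cubic_multiples V e"
| add: "G \<in> cubic_multiples V e \<Longrightarrow> f \<in> V \<Longrightarrow> h \<in> forms3 e \<Longrightarrow> (\<lambda>z. G z + f z * h z) \<in> cubic_multiples V e"

lemma cubic_multiples_single: "f \<in> V \<Longrightarrow> h \<in> forms3 e \<Longrightarrow> (\<lambda>z. f z * h z) \<in> cubic_multiples V e"
  using cubic_multiples.add[OF cubic_multiples.zero] by simp

lemma cubic_multiples_add:
  assumes "F \<in> cubic_multiples V e"
  shows "G \<in> cubic_multiples V e \<Longrightarrow> (\<lambda>z. F z + G z) \<in> cubic_multiples V e"
proof (induction rule: cubic_multiples.induct)
  case zero
  then show ?case using assms by simp
next
  case (add G f h)
  from cubic_multiples.add[OF add.IH add.hyps(2,3)] show ?case by (simp add: add.assoc)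
qed

lemma cubic_multiples_mult:
  assumes "r \<in> forms3 d"
  shows "G \<in> cubic_multiples V e \<Longrightarrow> (\<lambda>z. G z * r z) \<in> cubic_multiples V (e + d)"
proof (induction rule: cubic_multiples.induct)
  case zero
  then show ?case using cubic_multiples.zero by simp
next
  case (add G f h)
  from cubic_multiples.add[OF add.IH add.hyps(2) graded_mult[OF graded_forms3 add.hyps(3) assms]]
  show ?case by (simp add: algebra_simps)
qed

locale cubic_system =
  fixes V :: "((complex \<times> complex \<times> complex) \<Rightarrow> complex) set"
  assumes cubics: "V \<subseteq> forms3 3"
    and closed: "f \<in> V \<Longrightarrow> g \<in> V \<Longrightarrow> (\<lambda>z. f z + c * g z) \<in> V"
    and base_point_free: "z \<noteq> 0 \<Longrightarrow> \<exists>f\<in>V. f z \<noteq> 0"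
begin

lemma cubic_multiples_forms3: "G \<in> cubic_multiples V e \<Longrightarrow> G \<in> forms3 (e + 3)"
proof (induction rule: cubic_multiples.induct)
  case zero
  then show ?case by (rule graded_zero[OF graded_forms3])
next
  case (add G f h)
  have "(\<lambda>z. f z * h z) \<in> forms3 (e + 3)"
    using graded_mult[OF graded_forms3, of f 3 h e] add.hyps cubics by (auto simp: add.commute)
  from graded_add[OF graded_forms3 add.IH this] show ?case .
qed

text \<open>In the pencil \<open>f + c * g\<close> each of the finitely many points rules out at
  most one value of \<open>c\<close>.\<close>

lemma nonvanishing_member:
  assumes "finite E" "0 \<notin> E"
  shows "\<exists>f\<in>V. \<forall>z\<in>E. f z \<noteq> 0"
  using assms
proof (induction E rule: finite_induct)
  case empty
  from base_point_free[of "(1, 0, 0)"] show ?case by (auto simp: zero_prod_def)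
next
  case (insert z E)
  then obtain f where f: "f \<in> V" "\<forall>z\<in>E. f z \<noteq> 0" by auto
  from insert.prems base_point_free obtain g where g: "g \<in> V" "g z \<noteq> 0" by fastforce
  have "finite (insert 0 ((\<lambda>y. - f y / g y) ` insert z E))" using insert.hyps by simp
  from ex_new_if_finite[OF infinite_UNIV_char_0 this] obtain c
    where c: "c \<notin> insert 0 ((\<lambda>y. - f y / g y) ` insert z E)" by blast
  have "f y + c * g y \<noteq> 0" if y: "y \<in> insert z E" for y
  proof (cases "g y = 0")
    case True
    then show ?thesis using y f(2) g(2) by auto
  next
    case False
    have "c \<noteq> - f y / g y" using c y by blast
    then show ?thesis using False by (simp add: field_simps add_eq_0_iff)
  qed
  then show ?case using closed[OF f(1) g(1)] by (intro bexI[of _ "\<lambda>z. f z + c * g z"]) auto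
qed

text \<open>On the line where the first variable is 0, \<open>f1\<close> is chosen nonzero at
  infinity. It then has finitely many zeros on the line, and \<open>f2\<close> is chosen to avoid
  them.\<close>

lemma coprime_members:
  obtains f1 f2 where "f1 \<in> V" "f2 \<in> V" "coprime_binary_cubics (\<lambda>v. f1 (0, v)) (\<lambda>v. f2 (0, v))"
proof -
  from base_point_free[of "(0, 1, 0)"] obtain f1 where f1: "f1 \<in> V" "f1 (0, 1, 0) \<noteq> 0"
    by (auto simp: zero_prod_def)
  have r: "(\<lambda>v. f (0, v)) \<in> forms2 3" if "f \<in> V" for f
    using ext_at_0[OF graded_forms2] that cubics by blast
  from binary_poly[OF r[OF f1(1)]] obtain p where p: "\<forall>s. f1 (0, s, 1) = poly p s" "f1 (0, 1, 0) = coeff p 3"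
    by auto
  then have "p \<noteq> 0" using f1(2) by auto
  define E where "E = (\<lambda>s. (0 :: complex, s, 1 :: complex)) ` {s. poly p s = 0}"
  have "finite E" using \<open>p \<noteq> 0\<close> by (simp add: E_def poly_roots_finite)
  moreover have "0 \<notin> E" by (auto simp: E_def zero_prod_def)
  ultimately obtain f2 where "f2 \<in> V" "\<forall>z\<in>E. f2 z \<noteq> 0" using nonvanishing_member by blast
  then have f2: "f2 \<in> V" "\<forall>s. poly p s = 0 \<longrightarrow> f2 (0, s, 1) \<noteq> 0" by (auto simp: E_def)
  have "coprime_binary_cubics (\<lambda>v. f1 (0, v)) (\<lambda>v. f2 (0, v))"
    by unfold_locales (use r f1 f2 p in auto)
  with f1 f2 that show thesis by blast
qed

text \<open>The restriction of \<open>g\<close> to the line is generated by those of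
  \<open>f1\<close> and \<open>f2\<close>. With the cofactors lifted, the difference vanishes on the
  line and is divisible by the first variable.\<close>

lemma reduce:
  assumes f: "f1 \<in> V" "f2 \<in> V" "coprime_binary_cubics (\<lambda>v. f1 (0, v)) (\<lambda>v. f2 (0, v))"
    and "g \<in> forms3 (k + 3)" "k \<ge> 2"
  shows "\<exists>a\<in>forms3 k. \<exists>b\<in>forms3 k. \<exists>h\<in>forms3 (k + 2). g = (\<lambda>z. fst z * h z + f1 z * a z + f2 z * b z)"
proof -
  interpret coprime_binary_cubics "\<lambda>v. f1 (0, v)" "\<lambda>v. f2 (0, v)" by fact
  from generate_binary[OF ext_at_0[OF graded_forms2 assms(4)] assms(5)]
  obtain a b where ab: "a \<in> forms2 k" "b \<in> forms2 k"
    "(\<lambda>v. g (0, v)) = (\<lambda>v. f1 (0, v) * a v + f2 (0, v) * b v)" by blast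
  note lift = ext_snd[OF graded_forms2 ab(1)] ext_snd[OF graded_forms2 ab(2)]
  define D where "D z = g z - f1 z * a (snd z) - f2 z * b (snd z)" for z
  have "D \<in> forms3 (Suc (k + 2))"
  proof -
    have "(\<lambda>z. f1 z * a (snd z)) \<in> forms3 (k + 3)" "(\<lambda>z. f2 z * b (snd z)) \<in> forms3 (k + 3)"
      using graded_mult[OF graded_forms3 _ lift(1), of f1 3] graded_mult[OF graded_forms3 _ lift(2), of f2 3]
        f cubics by (auto simp: add.commute)
    from graded_diff[OF graded_forms3 graded_diff[OF graded_forms3 assms(4) this(1)] this(2)]
    show ?thesis by (simp add: D_def[abs_def] numeral_3_eq_3)
  qed
  moreover have "D (0, v) = 0" for v using fun_cong[OF ab(3), of v] by (simp add: D_def)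
  ultimately obtain h where h: "h \<in> forms3 (k + 2)" "D = (\<lambda>z. fst z * h z)"
    using ext_divide[OF graded_forms2] by blast
  have "g z = fst z * h z + f1 z * a (snd z) + f2 z * b (snd z)" for z
    using fun_cong[OF h(2), of z] by (simp add: D_def algebra_simps)
  then have "g = (\<lambda>z. fst z * h z + f1 z * a (snd z) + f2 z * b (snd z))" by blast
  then show ?thesis by (intro bexI[OF _ lift(1)] bexI[OF _ lift(2)] bexI[OF _ h(1)])
qed

text \<open>The first variable is not a zero divisor modulo \<open>f1\<close> and \<open>f2\<close>:
  on the line \<open>(a, b)\<close> is a Koszul syzygy. Subtracting its lift does not change
  \<open>f1 * a + f2 * b\<close> and makes both cofactors divisible by that variable.\<close>

lemma cancel_fst:
  assumes f: "f1 \<in> V" "f2 \<in> V" "coprime_binary_cubics (\<lambda>v. f1 (0, v)) (\<lambda>v. f2 (0, v))"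
    and "g \<in> forms3 d" "a \<in> forms3 (k + 3)" "b \<in> forms3 (k + 3)" "\<And>z. fst z * g z = f1 z * a z + f2 z * b z"
  shows "\<exists>a'\<in>forms3 (k + 2). \<exists>b'\<in>forms3 (k + 2). g = (\<lambda>z. f1 z * a' z + f2 z * b' z)"
proof -
  interpret coprime_binary_cubics "\<lambda>v. f1 (0, v)" "\<lambda>v. f2 (0, v)" by fact
  have f': "f1 \<in> forms3 3" "f2 \<in> forms3 3" using f cubics by auto
  have "f1 (0, v) * a (0, v) + f2 (0, v) * b (0, v) = 0" for v using assms(7)[of "(0, v)"] by simp
  from syzygy_binary[OF ext_at_0[OF graded_forms2 assms(5)] ext_at_0[OF graded_forms2 assms(6)] this]
  obtain e where e: "e \<in> forms2 k" "(\<lambda>v. a (0, v)) = (\<lambda>v. e v * f2 (0, v))"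
    "(\<lambda>v. b (0, v)) = (\<lambda>v. - 1 * (e v * f1 (0, v)))" by blast
  note lift = ext_snd[OF graded_forms2 e(1)]
  have "(\<lambda>z. a z - e (snd z) * f2 z) \<in> forms3 (Suc (k + 2))" "(\<lambda>z. b z + e (snd z) * f1 z) \<in> forms3 (Suc (k + 2))"
    using graded_diff[OF graded_forms3 assms(5) graded_mult[OF graded_forms3 lift f'(2)]]
      graded_add[OF graded_forms3 assms(6) graded_mult[OF graded_forms3 lift f'(1)]]
    by (simp_all add: numeral_3_eq_3)
  from this[THEN ext_divide[OF graded_forms2]] obtain a' b' where ab: "a' \<in> forms3 (k + 2)" "b' \<in> forms3 (k + 2)"
    "(\<lambda>z. a z - e (snd z) * f2 z) = (\<lambda>z. fst z * a' z)" "(\<lambda>z. b z + e (snd z) * f1 z) = (\<lambda>z. fst z * b' z)"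
    using fun_cong[OF e(2)] fun_cong[OF e(3)] by auto
  have "(\<lambda>z. f1 z * a' z) \<in> forms3 (3 + (k + 2))" "(\<lambda>z. f2 z * b' z) \<in> forms3 (3 + (k + 2))"
    by (intro graded_mult[OF graded_forms3] f' ab)+
  from graded_add[OF graded_forms3 this]
  have "g = (\<lambda>z. f1 z * a' z + f2 z * b' z)"
  proof (rule ext_eq_punctured[OF graded_forms2 assms(4)])
    fix x :: complex and v :: "complex \<times> complex"
    assume x: "x \<noteq> 0"
    have "x * g (x, v) = f1 (x, v) * a (x, v) + f2 (x, v) * b (x, v)" using assms(7)[of "(x, v)"] by simp
    also have "a (x, v) = x * a' (x, v) + e v * f2 (x, v)"
      using fun_cong[OF ab(3), of "(x, v)"] by (simp add: algebra_simps)
    also have "b (x, v) = x * b' (x, v) - e v * f1 (x, v)"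
      using fun_cong[OF ab(4), of "(x, v)"] by (simp add: algebra_simps)
    finally have "x * g (x, v) = x * (f1 (x, v) * a' (x, v) + f2 (x, v) * b' (x, v))"
      by (simp add: algebra_simps)
    with x show "g (x, v) = f1 (x, v) * a' (x, v) + f2 (x, v) * b' (x, v)" by simp
  qed
  with ab show ?thesis by blast
qed

text \<open>It is the cofactor \<open>h\<close> that gets reduced, not the product
  \<open>f * h\<close>; this keeps \<open>f * h'\<close> in the ideal. The degree
  \<open>k + 1\<close> of \<open>h\<close> has to be at least 5, which is the origin of
  \<open>k \<ge> 4\<close>.\<close>

lemma cubic_multiples_reduce:
  assumes f: "f1 \<in> V" "f2 \<in> V" "coprime_binary_cubics (\<lambda>v. f1 (0, v)) (\<lambda>v. f2 (0, v))" and "k \<ge> 4"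
  shows "G \<in> cubic_multiples V (Suc k) \<Longrightarrow> \<exists>G'\<in>cubic_multiples V k. \<exists>a\<in>forms3 (Suc k). \<exists>b\<in>forms3 (Suc k).
    G = (\<lambda>z. fst z * G' z + f1 z * a z + f2 z * b z)"
proof (induction rule: cubic_multiples.induct)
  case zero
  show ?case
    by (intro bexI[OF _ cubic_multiples.zero] bexI[OF _ graded_zero[OF graded_forms3]]) auto
next
  case (add G f h)
  then obtain G' a b where *: "G' \<in> cubic_multiples V k" "a \<in> forms3 (Suc k)" "b \<in> forms3 (Suc k)"
    "G = (\<lambda>z. fst z * G' z + f1 z * a z + f2 z * b z)" by blast
  define m where "m = k - 2"
  have m: "k = m + 2" "2 \<le> m" using assms(4) by (auto simp: m_def)
  have "h \<in> forms3 (m + 3)" using add.hyps(3) m(1) by (simp add: numeral_3_eq_3)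
  from reduce[OF f this m(2)] obtain c d h' where cd: "c \<in> forms3 m" "d \<in> forms3 m" "h' \<in> forms3 k"
    "h = (\<lambda>z. fst z * h' z + f1 z * c z + f2 z * d z)" using m(1) by blast
  have fc: "(\<lambda>z. f z * c z) \<in> forms3 (Suc k)" "(\<lambda>z. f z * d z) \<in> forms3 (Suc k)"
    using graded_mult[OF graded_forms3 _ cd(1), of f 3] graded_mult[OF graded_forms3 _ cd(2), of f 3]
      add.hyps(2) cubics m(1) by (auto simp: numeral_3_eq_3)
  have "(\<lambda>z. G z + f z * h z) =
    (\<lambda>z. fst z * (G' z + f z * h' z) + f1 z * (a z + f z * c z) + f2 z * (b z + f z * d z))"
    by (auto simp: *(4) cd(4) algebra_simps)
  then show ?case
    by (intro bexI[OF _ cubic_multiples.add[OF *(1) add.hyps(2) cd(3)]]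
      bexI[OF _ graded_add[OF graded_forms3 *(2) fc(1)]] bexI[OF _ graded_add[OF graded_forms3 *(3) fc(2)]])
qed

text \<open>Modulo \<open>f1\<close> and \<open>f2\<close>, the product \<open>fst * g\<close>
  equals \<open>fst * G'\<close> with \<open>G'\<close> in the ideal. Cancelling \<open>fst\<close>
  leaves \<open>g - G'\<close> in the ideal of \<open>f1\<close> and \<open>f2\<close>.\<close>

lemma cubic_multiples_saturated:
  assumes "g \<in> forms3 (k + 3)" "(\<lambda>z. fst z * g z) \<in> cubic_multiples V (Suc k)" "k \<ge> 4"
  shows "g \<in> cubic_multiples V k"
proof -
  obtain f1 f2 where f: "f1 \<in> V" "f2 \<in> V" "coprime_binary_cubics (\<lambda>v. f1 (0, v)) (\<lambda>v. f2 (0, v))"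
    by (rule coprime_members)
  from cubic_multiples_reduce[OF f assms(3,2)] obtain G' a b where
    *: "G' \<in> cubic_multiples V k" "a \<in> forms3 (Suc k)" "b \<in> forms3 (Suc k)"
    "(\<lambda>z. fst z * g z) = (\<lambda>z. fst z * G' z + f1 z * a z + f2 z * b z)" by blast
  define m where "m = k - 2"
  have m: "k = m + 2" using assms(3) by (auto simp: m_def)
  have ab: "a \<in> forms3 (m + 3)" "b \<in> forms3 (m + 3)" using * m by (simp_all add: numeral_3_eq_3)
  have G': "G' \<in> forms3 (k + 3)" by (rule cubic_multiples_forms3[OF *(1)])
  have "fst z * (g z - G' z) = f1 z * a z + f2 z * b z" for z
    using fun_cong[OF *(4), of z] by (simp add: algebra_simps)
  from cancel_fst[OF f graded_diff[OF graded_forms3 assms(1) G'] ab this] obtain a' b'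
    where ab': "a' \<in> forms3 k" "b' \<in> forms3 k" "(\<lambda>z. g z - G' z) = (\<lambda>z. f1 z * a' z + f2 z * b' z)"
    using m by blast
  have "g = (\<lambda>z. G' z + f1 z * a' z + f2 z * b' z)"
  proof
    fix z
    show "g z = G' z + f1 z * a' z + f2 z * b' z" using fun_cong[OF ab'(3), of z] by (simp add: algebra_simps)
  qed
  then show ?thesis
    using cubic_multiples.add[OF cubic_multiples.add[OF *(1) f(1) ab'(1)] f(2) ab'(2)] by simp
qed

section \<open>The ideal on the affine chart where the first variable is 1\<close>

lemma fst_power_forms3: "(\<lambda>z. fst z ^ n) \<in> forms3 n"
  using graded_power[OF graded_forms3 fst_in_ext[OF graded_forms2], of n] by simp

definition affine_multiples :: "(complex \<times> complex \<Rightarrow> complex) set" where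
  "affine_multiples = {\<lambda>v. G (1, v) | G. \<exists>e. G \<in> cubic_multiples V e}"

lemma affine_multiplesI: "G \<in> cubic_multiples V e \<Longrightarrow> (\<lambda>v. G (1, v)) \<in> affine_multiples"
  by (auto simp: affine_multiples_def)

lemma affine_multiples_ideal: "affine_ideal affine_multiples"
  unfolding affine_ideal_def
proof (intro conjI ballI)
  show "(\<lambda>_. 0) \<in> affine_multiples" using affine_multiplesI[OF cubic_multiples.zero] by simp
next
  fix f g assume "f \<in> affine_multiples" "g \<in> affine_multiples"
  then obtain F d G e where *: "f = (\<lambda>v. F (1, v))" "F \<in> cubic_multiples V d"
    "g = (\<lambda>v. G (1, v))" "G \<in> cubic_multiples V e" unfolding affine_multiples_def by blast
  from cubic_multiples_mult[OF fst_power_forms3 *(2), of e] cubic_multiples_mult[OF fst_power_forms3 *(4), of d]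
  have "(\<lambda>z. F z * fst z ^ e + G z * fst z ^ d) \<in> cubic_multiples V (d + e)"
    by (intro cubic_multiples_add) (simp_all add: add.commute)
  from affine_multiplesI[OF this] show "(\<lambda>v. f v + g v) \<in> affine_multiples" by (simp add: *)
next
  fix f r assume "f \<in> affine_multiples" and r: "r \<in> affine_poly"
  then obtain F d where *: "f = (\<lambda>v. F (1, v))" "F \<in> cubic_multiples V d"
    unfolding affine_multiples_def by blast
  from affine_forms3[OF r] obtain e R where R: "R \<in> forms3 e" "r = (\<lambda>v. R (1, v))" by blast
  from affine_multiplesI[OF cubic_multiples_mult[OF R(1) *(2)]]
  show "(\<lambda>v. f v * r v) \<in> affine_multiples" by (simp add: * R)
qed

text \<open>On the chart the first variable is 1, so \<open>reduce\<close> lowers a degree of at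
  least 5 by one modulo the ideal; smaller degrees are padded up to 4. Hence the quotient ring is
  spanned by the images of quartics and is finite-dimensional.\<close>

lemma affine_reduce:
  "g \<in> forms3 d \<Longrightarrow> \<exists>h\<in>forms3 4. (\<lambda>v. g (1, v) - h (1, v)) \<in> affine_multiples"
proof (induction d arbitrary: g)
  case 0
  from graded_mult[OF graded_forms3 fst_power_forms3[of 4] 0] show ?case
    by (auto intro!: bexI[of _ "\<lambda>z. fst z ^ 4 * g z"] affine_ideal_zero[OF affine_multiples_ideal])
next
  case (Suc d)
  show ?case
  proof (cases "Suc d \<le> 4")
    case True
    with graded_mult[OF graded_forms3 fst_power_forms3[of "4 - Suc d"] Suc.prems]
    have "(\<lambda>z. fst z ^ (4 - Suc d) * g z) \<in> forms3 4" by (simp only: le_add_diff_inverse2)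
    then show ?thesis
      by (rule bexI[rotated]) (simp add: affine_ideal_zero[OF affine_multiples_ideal])
  next
    case False
    define k where "k = d - 2"
    have k: "Suc d = k + 3" "d = k + 2" "2 \<le> k" using False by (auto simp: k_def)
    obtain f1 f2 where f: "f1 \<in> V" "f2 \<in> V" "coprime_binary_cubics (\<lambda>v. f1 (0, v)) (\<lambda>v. f2 (0, v))"
      by (rule coprime_members)
    from reduce[OF f Suc.prems[unfolded k(1)] k(3)] obtain a b g' where *: "a \<in> forms3 k" "b \<in> forms3 k"
      "g' \<in> forms3 d" "g = (\<lambda>z. fst z * g' z + f1 z * a z + f2 z * b z)" unfolding k(2) by blast
    from Suc.IH[OF *(3)] obtain h where h: "h \<in> forms3 4" "(\<lambda>v. g' (1, v) - h (1, v)) \<in> affine_multiples"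
      by blast
    have "(\<lambda>v. f1 (1, v) * a (1, v) + f2 (1, v) * b (1, v)) \<in> affine_multiples"
      by (rule affine_multiplesI[OF cubic_multiples.add[OF cubic_multiples_single[OF f(1) *(1)] f(2) *(2)]])
    from affine_ideal_add[OF affine_multiples_ideal h(2) this] h(1) show ?thesis
      by (intro bexI[of _ h]) (simp_all add: * algebra_simps)
  qed
qed

text \<open>The powers of \<open>X\<close> are congruent to quartics. As these form a
  finite-dimensional space, some linear combination of the powers lies in the ideal.\<close>

lemma annihilating_polynomial:
  assumes "X \<in> forms3 1"
  shows "\<exists>p. p \<noteq> 0 \<and> (\<lambda>v. poly p (X (1, v))) \<in> affine_multiples"
proof -
  have "\<forall>i. \<exists>h\<in>forms3 4. (\<lambda>v. X (1, v) ^ i - h (1, v)) \<in> affine_multiples"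
    using affine_reduce graded_power[OF graded_forms3 assms] by blast
  then obtain h where h: "\<And>i. h i \<in> forms3 4" "\<And>i. (\<lambda>v. X (1, v) ^ i - h i (1, v)) \<in> affine_multiples"
    by metis
  from fin_spanned_dependent[OF fin_spanned_forms3[of 4]] h(1) obtain n :: nat and c
    where c: "\<exists>i\<le>n. c i \<noteq> 0" "\<And>z. (\<Sum>i\<le>n. c i * h i z) = 0" by blast
  define p where "p = (\<Sum>i\<le>n. monom (c i) i)"
  have "coeff p i = c i" if "i \<le> n" for i using that by (simp add: p_def coeff_sum)
  with c(1) have "p \<noteq> 0" by auto
  have "(\<lambda>v. \<Sum>i\<in>N. c i * (X (1, v) ^ i - h i (1, v))) \<in> affine_multiples" if "finite N" for N
    using that
  proof induction
    case empty
    show ?case using affine_ideal_zero[OF affine_multiples_ideal] by simp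
  next
    case (insert i N)
    from affine_ideal_mult[OF affine_multiples_ideal h(2)[of i] affine_const[of "c i"]]
    have "(\<lambda>v. c i * (X (1, v) ^ i - h i (1, v))) \<in> affine_multiples" by (simp add: mult.commute)
    from affine_ideal_add[OF affine_multiples_ideal this insert.IH] insert.hyps show ?case by simp
  qed
  from this[of "{..n}"] have "(\<lambda>v. poly p (X (1, v))) \<in> affine_multiples"
    by (simp add: p_def poly_sum poly_monom right_diff_distrib sum_subtractf c(2))
  with \<open>p \<noteq> 0\<close> show ?thesis by blast
qed

lemma fst_power_in_cubic_multiples: "\<exists>n. (\<lambda>z. fst z ^ (n + 3)) \<in> cubic_multiples V n"
proof -
  from annihilating_polynomial[OF ext_snd[OF graded_forms2 fst_snd_in_forms2(1)]] obtain p
    where p: "p \<noteq> 0" "(\<lambda>v. poly p (fst v)) \<in> affine_multiples" by auto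
  from annihilating_polynomial[OF ext_snd[OF graded_forms2 fst_snd_in_forms2(2)]] obtain q
    where q: "q \<noteq> 0" "(\<lambda>v. poly q (snd v)) \<in> affine_multiples" by auto
  have "\<exists>f\<in>affine_multiples \<inter> affine_poly. f (a, b) \<noteq> 0" for a b
  proof -
    from base_point_free[of "(1, a, b)"] obtain f where f: "f \<in> V" "f (1, a, b) \<noteq> 0"
      by (auto simp: zero_prod_def)
    from affine_multiplesI[OF cubic_multiples_single[OF f(1) graded_const[OF graded_forms3, of 1]]]
      forms3_affine[of f 3] f cubics show ?thesis
      by (intro bexI[of _ "\<lambda>v. f (1, v)"]) auto
  qed
  from affine_nullstellensatz[OF affine_multiples_ideal p q this]
  obtain n G where G: "(\<lambda>_. 1) = (\<lambda>v. G (1, v))" "G \<in> cubic_multiples V n"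
    unfolding affine_multiples_def by blast
  \<comment> \<open>By homogeneity \<open>G\<close> is determined off the plane at infinity by its
    constant value 1 on the chart.\<close>
  have "G = (\<lambda>z. fst z ^ (n + 3))"
  proof (rule ext_eq_punctured[OF graded_forms2 cubic_multiples_forms3[OF G(2)] fst_power_forms3])
    fix x :: complex and v :: "complex \<times> complex"
    assume x: "x \<noteq> 0"
    obtain s t where v: "v = (s, t)" by (cases v)
    have "G (map_prod ((*) x) (map_prod ((*) x) ((*) x)) (1, s / x, t / x)) = x ^ (n + 3) * G (1, s / x, t / x)"
      using homogeneous_forms3 cubic_multiples_forms3[OF G(2)] unfolding homogeneous_def by blast
    then show "G (x, v) = fst (x, v) ^ (n + 3)" using x fun_cong[OF G(1), of "(s / x, t / x)"] by (simp add: v)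
  qed
  with G(2) show ?thesis by blast
qed

text \<open>
  Macaulay's bound: some power of the first variable is a multiple of members of \<open>V\<close>, and the first
  variable can be cancelled.
\<close>

lemma forms3_eq_cubic_multiples:
  assumes "k \<ge> 4" "g \<in> forms3 (k + 3)"
  shows "g \<in> cubic_multiples V k"
proof -
  have descend: "(\<lambda>z. fst z ^ n * g z) \<in> cubic_multiples V (k + n) \<Longrightarrow> g \<in> cubic_multiples V k" for n
  proof (induction n)
    case (Suc n)
    have "(\<lambda>z. fst z ^ n * g z) \<in> forms3 (k + n + 3)"
      using graded_mult[OF graded_forms3 fst_power_forms3 assms(2), of n] by (simp only: ac_simps)
    from cubic_multiples_saturated[OF this] Suc.prems assms(1) have "(\<lambda>z. fst z ^ n * g z) \<in> cubic_multiples V (k + n)"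
      by (simp add: mult.assoc)
    then show ?case by (rule Suc.IH)
  qed simp
  from fst_power_in_cubic_multiples obtain n where "(\<lambda>z. fst z ^ (n + 3)) \<in> cubic_multiples V n" by blast
  from cubic_multiples_mult[OF assms(2) this]
  have "(\<lambda>z. fst z ^ (n + 3) * g z) \<in> cubic_multiples V (k + (n + 3))" by (simp add: add.commute add.left_commute)
  then show ?thesis by (rule descend)
qed

end


section \<open>Evaluation of forms and apolarity\<close>

definition mdeg :: "(4 \<Rightarrow>\<^sub>0 nat) \<Rightarrow> nat" where
  "mdeg m = (\<Sum>i\<in>UNIV. Poly_Mapping.lookup m i)"

definition mval :: "(4 \<Rightarrow>\<^sub>0 nat) \<Rightarrow> complex ^ 4 \<Rightarrow> complex" where
  "mval m x = (\<Prod>i\<in>UNIV. x $ i ^ Poly_Mapping.lookup m i)"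

lemma mdeg_add: "mdeg (m + n) = mdeg m + mdeg n"
  by (simp add: mdeg_def lookup_add sum.distrib)

lemma mdeg_single [simp]: "mdeg (Poly_Mapping.single i k) = k"
  by (simp add: mdeg_def lookup_single when_def)

lemma mval_add: "mval (m + n) x = mval m x * mval n x"
  by (simp add: mval_def lookup_add power_add prod.distrib)

lemma mval_single [simp]: "mval (Poly_Mapping.single i k) x = x $ i ^ k"
proof -
  have "mval (Poly_Mapping.single i k) x = (\<Prod>j\<in>UNIV. if j = i then x $ i ^ k else 1)"
    unfolding mval_def by (rule prod.cong) (auto simp: lookup_single when_def)
  then show ?thesis by simp
qed

lemma mval_scale: "mval m (c *s x) = c ^ mdeg m * mval m x"
  by (simp add: mval_def mdeg_def power_mult_distrib prod.distrib power_sum)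

lemma forms_iff: "p \<in> forms d \<longleftrightarrow> (\<forall>m. Poly_Mapping.lookup p m \<noteq> 0 \<longrightarrow> mdeg m = d)"
  by (auto simp: forms_def mdeg_def in_keys_iff)

lemma eval_superset:
  assumes "finite K" "Poly_Mapping.keys p \<subseteq> K"
  shows "eval p x = (\<Sum>m\<in>K. Poly_Mapping.lookup p m * mval m x)"
  unfolding eval_def mval_def[symmetric]
  by (rule sum.mono_neutral_left) (use assms in \<open>auto simp: in_keys_iff\<close>)

lemma eval_add: "eval (p + q) x = eval p x + eval q x"
proof -
  let ?K = "Poly_Mapping.keys p \<union> Poly_Mapping.keys q"
  have "Poly_Mapping.keys (p + q) \<subseteq> ?K" by (rule keys_add)
  then show ?thesis
    by (simp add: eval_superset[of ?K] lookup_add distrib_right sum.distrib)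
qed

lemma eval_0 [simp]: "eval 0 x = 0"
  by (simp add: eval_def)

lemma eval_single: "eval (Poly_Mapping.single m c) x = c * mval m x"
  by (subst eval_superset[of "{m}"]) auto

lemma eval_1 [simp]: "eval 1 x = 1"
  using eval_single[of 0 1 x] by (simp add: mval_def)

lemma eval_sum: "eval (\<Sum>i\<in>I. f i) x = (\<Sum>i\<in>I. eval (f i) x)"
  by (induction I rule: infinite_finite_induct) (auto simp: eval_add)

lemma cpoly_sum_single: "(p :: cpoly) = (\<Sum>m\<in>Poly_Mapping.keys p. Poly_Mapping.single m (Poly_Mapping.lookup p m))"
  by (rule poly_mapping_eqI) (auto simp: lookup_sum lookup_single when_def in_keys_iff)

lemma lookup_mult_single:
  "Poly_Mapping.lookup ((p :: cpoly) * Poly_Mapping.single e c) m =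
    (\<Sum>l\<in>Poly_Mapping.keys p. if l + e = m then Poly_Mapping.lookup p l * c else 0)"
proof -
  have "p * Poly_Mapping.single e c =
      (\<Sum>l\<in>Poly_Mapping.keys p. Poly_Mapping.single (l + e) (Poly_Mapping.lookup p l * c))"
    by (subst cpoly_sum_single[of p]) (simp add: sum_distrib_right mult_single)
  then show ?thesis by (simp add: lookup_sum lookup_single when_def)
qed

lemma eval_mult: "eval (p * q) x = eval p x * eval q x"
proof -
  have "p * q = (\<Sum>m\<in>Poly_Mapping.keys p. \<Sum>n\<in>Poly_Mapping.keys q.
      Poly_Mapping.single (m + n) (Poly_Mapping.lookup p m * Poly_Mapping.lookup q n))"
    by (subst cpoly_sum_single[of p], subst cpoly_sum_single[of q])
      (simp add: sum_product mult_single)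
  also have "eval \<dots> x = (\<Sum>m\<in>Poly_Mapping.keys p. \<Sum>n\<in>Poly_Mapping.keys q.
      (Poly_Mapping.lookup p m * mval m x) * (Poly_Mapping.lookup q n * mval n x))"
    by (simp add: eval_sum eval_single mval_add mult_ac)
  also have "\<dots> = eval p x * eval q x"
    by (simp add: eval_def mval_def[symmetric] sum_product)
  finally show ?thesis .
qed

lemma eval_cscale: "eval (cscale c p) x = c * eval p x"
  by (simp add: cscale_def eval_mult eval_single mval_def)

lemma lookup_cscale: "Poly_Mapping.lookup (cscale c p) m = c * Poly_Mapping.lookup p m"
proof -
  have "cscale c p = Poly_Mapping.map ((*) c) p"
    by (simp add: cscale_def mult_map_scale_conv_mult)
  then show ?thesis by (simp add: map.rep_eq when_def)
qed

lemma forms_0 [simp]: "0 \<in> forms d"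
  by (simp add: forms_iff)

lemma forms_add: "p \<in> forms d \<Longrightarrow> q \<in> forms d \<Longrightarrow> p + q \<in> forms d"
  unfolding forms_iff lookup_add by (metis add.right_neutral)

lemma forms_single: "mdeg m = d \<Longrightarrow> Poly_Mapping.single m c \<in> forms d"
  by (auto simp: forms_iff lookup_single when_def)

lemma forms_mult:
  assumes "p \<in> forms d" "q \<in> forms e"
  shows "p * q \<in> forms (d + e)"
proof -
  have "mdeg m = d + e" if "m \<in> Poly_Mapping.keys (p * q)" for m
  proof -
    from that keys_mult[of p q] obtain a b where "m = a + b" "a \<in> Poly_Mapping.keys p" "b \<in> Poly_Mapping.keys q"
      by blast
    with assms show ?thesis by (auto simp: forms_iff in_keys_iff mdeg_add)
  qed
  then show ?thesis by (auto simp: forms_iff in_keys_iff)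
qed

lemma forms_cscale: "p \<in> forms d \<Longrightarrow> cscale c p \<in> forms d"
  by (simp add: forms_iff lookup_cscale)

lemma forms_diff: "p \<in> forms d \<Longrightarrow> q \<in> forms d \<Longrightarrow> p - q \<in> forms d"
  unfolding forms_iff lookup_minus by (metis diff_zero)

lemma eval_scale:
  assumes "G \<in> forms d"
  shows "eval G (c *s x) = c ^ d * eval G x"
proof -
  have "eval G (c *s x) = (\<Sum>m\<in>Poly_Mapping.keys G. c ^ d * (Poly_Mapping.lookup G m * mval m x))"
    unfolding eval_def mval_def[symmetric]
    by (rule sum.cong) (use assms in \<open>auto simp: mval_scale forms_iff in_keys_iff\<close>)
  then show ?thesis by (simp add: eval_def mval_def[symmetric] sum_distrib_left)
qed

text \<open>The bridge from polynomial mappings to graded families of functions.\<close>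

definition form_functions :: "nat \<Rightarrow> (complex ^ 4 \<Rightarrow> complex) set" where
  "form_functions d = eval ` forms d"

lemma graded_form_functions: "graded form_functions"
  unfolding graded_def
proof (intro conjI allI impI)
  show "(\<lambda>_. 0) \<in> form_functions d" for d
    unfolding form_functions_def by (rule image_eqI[of _ _ 0]) auto
  show "(\<lambda>_. c) \<in> form_functions 0" for c
    unfolding form_functions_def
    by (rule image_eqI[OF _ forms_single[of 0 0 c]]) (auto simp: eval_single mval_def mdeg_def)
next
  fix d f g assume "f \<in> form_functions d" "g \<in> form_functions d"
  then obtain p q where *: "f = eval p" "p \<in> forms d" "g = eval q" "q \<in> forms d"
    by (auto simp: form_functions_def)
  show "(\<lambda>v. f v + g v) \<in> form_functions d"
    unfolding form_functions_def by (rule image_eqI[OF _ forms_add[OF *(2,4)]]) (simp add: * eval_add fun_eq_iff)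
next
  fix d e f g assume "f \<in> form_functions d" "g \<in> form_functions e"
  then obtain p q where *: "f = eval p" "p \<in> forms d" "g = eval q" "q \<in> forms e"
    by (auto simp: form_functions_def)
  show "(\<lambda>v. f v * g v) \<in> form_functions (d + e)"
    unfolding form_functions_def by (rule image_eqI[OF _ forms_mult[OF *(2,4)]]) (simp add: * eval_mult fun_eq_iff)
qed

lemma coordinate_form_function: "(\<lambda>x. x $ i) \<in> form_functions 1"
  unfolding form_functions_def
  by (rule image_eqI[OF _ forms_single[of "Poly_Mapping.single i 1" 1 1]]) (auto simp: eval_single)

section \<open>Representatives of points and forms separating points\<close>

lemma rep_abs_P3:
  assumes "x \<noteq> 0"
  shows "\<exists>c. c \<noteq> 0 \<and> rep_P3 (abs_P3 x) = c *s x"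
proof -
  have "proportional x x" using assms by (auto simp: proportional_def intro!: exI[of _ 1])
  then have "proportional (rep_P3 (abs_P3 x)) x" by (rule rep_abs_rsp_left[OF Quotient3_P3])
  then obtain c where c: "x = c *s rep_P3 (abs_P3 x)" by (auto simp: proportional_def)
  with assms have "c \<noteq> 0" by auto
  then have "rep_P3 (abs_P3 x) = inverse c *s x" by (subst (2) c) (simp add: vector_smult_assoc)
  with \<open>c \<noteq> 0\<close> show ?thesis by (intro exI[of _ "inverse c"]) simp
qed

lemma vanishes_at_abs:
  assumes "G \<in> forms d" "x \<noteq> 0"
  shows "vanishes_at G (abs_P3 x) \<longleftrightarrow> eval G x = 0"
proof -
  from rep_abs_P3[OF assms(2)] obtain c where "c \<noteq> 0" "rep_P3 (abs_P3 x) = c *s x" by blast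
  then show ?thesis by (simp add: vanishes_at_def eval_scale[OF assms(1)])
qed

lemma abs_rep_P3: "abs_P3 (rep_P3 P) = P"
  using Quotient3_P3 by (rule Quotient3_abs_rep)

lemma P3_eqI:
  assumes "rep_P3 P = c *s rep_P3 Q"
  shows "P = Q"
proof -
  have "proportional (rep_P3 Q) (rep_P3 P)"
    using assms rep_P3_nonzero by (auto simp: proportional_def)
  then have "abs_P3 (rep_P3 Q) = abs_P3 (rep_P3 P)" using Quotient3_rel_abs[OF Quotient3_P3] by blast
  then show ?thesis by (simp add: abs_rep_P3)
qed

text \<open>The form is a nonzero 2 by 2 minor of the coordinates of both points, with those of
  \<open>P\<close> replaced by variables.\<close>

lemma separating_linear_form:
  assumes "P \<noteq> Q"
  shows "\<exists>G\<in>forms 1. vanishes_at G Q \<and> \<not> vanishes_at G P"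
proof -
  define u where "u = rep_P3 Q"
  define v where "v = rep_P3 P"
  have "u \<noteq> 0" by (simp add: u_def rep_P3_nonzero)
  then obtain i where i: "u $ i \<noteq> 0" by (auto simp: vec_eq_iff)
  have "\<exists>j. u $ i * v $ j \<noteq> u $ j * v $ i"
  proof (rule ccontr)
    assume "\<not> ?thesis"
    then have "v = (v $ i / u $ i) *s u" using i by (auto simp: vec_eq_iff field_simps)
    then show False using P3_eqI assms unfolding u_def v_def by blast
  qed
  then obtain j where j: "u $ i * v $ j \<noteq> u $ j * v $ i" ..
  define G where "G = Poly_Mapping.single (Poly_Mapping.single j 1) (u $ i)
    - (Poly_Mapping.single (Poly_Mapping.single i 1) (u $ j) :: cpoly)"
  have G: "G \<in> forms 1" unfolding G_def by (intro forms_diff forms_single) simp_all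
  have "eval G x = u $ i * x $ j - u $ j * x $ i" for x
    unfolding G_def diff_conv_add_uminus single_uminus[symmetric] eval_add eval_single by simp
  with j G show ?thesis by (intro bexI[of _ G]) (auto simp: vanishes_at_def u_def[symmetric] v_def[symmetric])
qed

lemma separating_form:
  assumes "finite E" "P \<notin> E"
  shows "\<exists>G\<in>forms (card E). (\<forall>Q\<in>E. vanishes_at G Q) \<and> \<not> vanishes_at G P"
  using assms
proof (induction E rule: finite_induct)
  case empty
  show ?case
    by (rule bexI[OF _ forms_single[of 0 _ 1]]) (simp_all add: vanishes_at_def eval_single mval_def mdeg_def)
next
  case (insert Q E)
  then obtain G where G: "G \<in> forms (card E)" "\<forall>Q\<in>E. vanishes_at G Q" "\<not> vanishes_at G P" by auto
  from separating_linear_form[of P Q] insert.prems obtain L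
    where L: "L \<in> forms 1" "vanishes_at L Q" "\<not> vanishes_at L P" by blast
  from forms_mult[OF L(1) G(1)] insert.hyps have "L * G \<in> forms (card (insert Q E))" by simp
  then show ?case
    by (rule bexI[rotated]) (use G L in \<open>auto simp: vanishes_at_def eval_mult\<close>)
qed

text \<open>\<open>k m\<close> stands for the multinomial coefficient. Apolarity needs only that it
  is nonzero, so it is built from its recursion over the last linear factor instead of
  factorials.\<close>

lemma lookup_linform_power:
  "\<exists>k. \<forall>m. (mdeg m = d \<longrightarrow> k m > 0) \<and>
    (\<forall>v. Poly_Mapping.lookup (linform v ^ d) m = (if mdeg m = d then of_nat (k m) * mval m v else 0))"
proof (induction d)
  case 0
  have "mdeg m = 0 \<longleftrightarrow> m = 0" for m :: "4 \<Rightarrow>\<^sub>0 nat"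
    by (simp add: mdeg_def poly_mapping_eq_iff fun_eq_iff)
  then show ?case
    by (intro exI[of _ "\<lambda>_. 1"]) (simp add: lookup_one when_def mval_def)
next
  case (Suc d)
  then obtain k where k: "\<And>m. mdeg m = d \<Longrightarrow> k m > 0"
    "\<And>m v. Poly_Mapping.lookup (linform v ^ d) m = (if mdeg m = d then of_nat (k m) * mval m v else 0)"
    by blast
  let ?e = "\<lambda>i. Poly_Mapping.single i 1 :: 4 \<Rightarrow>\<^sub>0 nat"
  \<comment> \<open>Truncated subtraction would leave \<open>m\<close> unchanged at an exponent 0,
    hence the restriction to the variables that occur in \<open>m\<close>.\<close>
  define K where "K m = (\<Sum>i | Poly_Mapping.lookup m i > 0. k (m - ?e i))" for m :: "4 \<Rightarrow>\<^sub>0 nat"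
  have sub: "m - ?e i + ?e i = m" if "Poly_Mapping.lookup m i > 0" for m i
    using that by (intro poly_mapping_eqI) (auto simp: lookup_add lookup_minus lookup_single when_def)
  have shift: "Poly_Mapping.lookup (p * Poly_Mapping.single (?e i) c) m =
      (if Poly_Mapping.lookup m i > 0 then c * Poly_Mapping.lookup p (m - ?e i) else 0)"
    for p :: cpoly and c i m
  proof -
    have iff: "l + ?e i = m \<longleftrightarrow> Poly_Mapping.lookup m i > 0 \<and> l = m - ?e i" for l
      using sub[of m i] by (auto simp: lookup_add)
    have "Poly_Mapping.lookup (p * Poly_Mapping.single (?e i) c) m =
        (\<Sum>l\<in>Poly_Mapping.keys p. if l + ?e i = m then Poly_Mapping.lookup p l * c else 0)"
      by (rule lookup_mult_single)
    also have "\<dots> = (if Poly_Mapping.lookup m i > 0 then c * Poly_Mapping.lookup p (m - ?e i) else 0)"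
      unfolding iff by (cases "Poly_Mapping.lookup m i > 0") (auto simp: in_keys_iff mult.commute sum.neutral)
    finally show ?thesis .
  qed
  show ?case
  proof (intro exI[of _ K] allI conjI impI)
    fix m assume m: "mdeg m = Suc d"
    have "\<exists>i. Poly_Mapping.lookup m i > 0"
    proof (rule ccontr)
      assume "\<not> ?thesis"
      then have "mdeg m = 0" by (simp add: mdeg_def)
      with m show False by simp
    qed
    then obtain i where i: "Poly_Mapping.lookup m i > 0" ..
    have "mdeg (m - ?e i) = d" using mdeg_add[of "m - ?e i" "?e i"] sub[OF i] m by simp
    from k(1)[OF this] i show "K m > 0" by (auto simp: K_def intro!: sum_pos2[of _ i])
  next
    fix m v
    have "Poly_Mapping.lookup (linform v ^ Suc d) m = Poly_Mapping.lookup (linform v ^ d * linform v) m"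
      by (simp add: mult.commute)
    also have "\<dots> = (\<Sum>i\<in>UNIV. if Poly_Mapping.lookup m i > 0 then v $ i * Poly_Mapping.lookup (linform v ^ d) (m - ?e i) else 0)"
      by (subst (2) linform_def) (simp only: sum_distrib_left lookup_sum shift)
    also have "\<dots> = (\<Sum>i | Poly_Mapping.lookup m i > 0. v $ i * Poly_Mapping.lookup (linform v ^ d) (m - ?e i))"
      by (simp add: sum.If_cases)
    also have "\<dots> = (\<Sum>i | Poly_Mapping.lookup m i > 0. if mdeg m = Suc d then of_nat (k (m - ?e i)) * mval m v else 0)"
    proof (rule sum.cong)
      fix i assume "i \<in> {i. Poly_Mapping.lookup m i > 0}"
      then have s: "m - ?e i + ?e i = m" using sub by simp
      have "mdeg m = Suc (mdeg (m - ?e i))" using mdeg_add[of "m - ?e i" "?e i", unfolded s] by simp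
      moreover have "mval m v = mval (m - ?e i) v * v $ i" using mval_add[of "m - ?e i" "?e i" v, unfolded s] by simp
      ultimately show "v $ i * Poly_Mapping.lookup (linform v ^ d) (m - ?e i) =
        (if mdeg m = Suc d then of_nat (k (m - ?e i)) * mval m v else 0)" by (simp add: k(2))
    qed simp
    also have "\<dots> = (if mdeg m = Suc d then of_nat (K m) * mval m v else 0)"
      by (simp add: K_def sum_distrib_right)
    finally show "Poly_Mapping.lookup (linform v ^ Suc d) m = (if mdeg m = Suc d then of_nat (K m) * mval m v else 0)" .
  qed
qed

text \<open>The coefficient at \<open>m\<close> of the relation is a positive multinomial
  coefficient times the weighted sum of the values of the monomial \<open>m\<close>. So the weights
  annihilate all monomials of degree \<open>d\<close>.\<close>

lemma relation_eval:
  assumes "(\<Sum>P\<in>Z. cscale (c P) (linform (x P) ^ d)) = 0" "G \<in> forms d"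
  shows "(\<Sum>P\<in>Z. c P * eval G (x P)) = 0"
proof -
  obtain k where k: "\<And>m. mdeg m = d \<Longrightarrow> k m > 0"
    "\<And>m v. Poly_Mapping.lookup (linform v ^ d) m = (if mdeg m = d then of_nat (k m) * mval m v else 0)"
    using lookup_linform_power[of d] by blast
  have mval: "(\<Sum>P\<in>Z. c P * mval m (x P)) = 0" if m: "mdeg m = d" for m
  proof -
    have "0 = Poly_Mapping.lookup (\<Sum>P\<in>Z. cscale (c P) (linform (x P) ^ d)) m" by (simp add: assms(1))
    also have "\<dots> = of_nat (k m) * (\<Sum>P\<in>Z. c P * mval m (x P))"
      by (simp add: lookup_sum lookup_cscale k(2) m sum_distrib_left mult_ac)
    finally show ?thesis using k(1)[OF m] by simp
  qed
  have "(\<Sum>P\<in>Z. c P * eval G (x P)) = (\<Sum>P\<in>Z. \<Sum>m\<in>Poly_Mapping.keys G. Poly_Mapping.lookup G m * (c P * mval m (x P)))"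
    by (simp add: eval_def mval_def[symmetric] sum_distrib_left mult_ac)
  also have "\<dots> = (\<Sum>m\<in>Poly_Mapping.keys G. Poly_Mapping.lookup G m * (\<Sum>P\<in>Z. c P * mval m (x P)))"
    by (subst sum.swap) (simp add: sum_distrib_left)
  also have "\<dots> = 0"
    by (rule sum.neutral) (use assms(2) mval in \<open>auto simp: forms_iff in_keys_iff\<close>)
  finally show ?thesis .
qed


section \<open>Infinite base loci contain curves\<close>

text \<open>The indices kept are those at which \<open>s\<close> attains its minimum over the tail
  that starts there.\<close>

lemma incseq_subsequence:
  fixes s :: "nat \<Rightarrow> nat"
  shows "\<exists>g :: nat \<Rightarrow> nat. strict_mono g \<and> (\<forall>i j. i \<le> j \<longrightarrow> s (g i) \<le> s (g j))"
proof -
  have least: "\<exists>y>x. \<forall>k\<ge>y. s y \<le> s k" for x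
  proof -
    obtain y where y: "y > x" "\<And>k. k > x \<Longrightarrow> s y \<le> s k"
      using ex_has_least_nat[of "\<lambda>k. k > x" "Suc x" s] by auto
    then show ?thesis by (intro exI[of _ y]) auto
  qed
  have "\<exists>f. \<forall>n. (\<forall>k\<ge>f n. s (f n) \<le> s k) \<and> f n < f (Suc n)"
    by (rule dependent_nat_choice) (use least in blast)+
  then obtain f where f: "\<And>n. \<forall>k\<ge>f n. s (f n) \<le> s k" "\<And>n. f n < f (Suc n)" by blast
  then have "strict_mono f" by (simp add: strict_mono_Suc_iff)
  with f(1) show ?thesis by (intro exI[of _ f]) (simp add: strict_mono_less_eq)
qed

lemma dickson:
  fixes m :: "nat \<Rightarrow> (4 \<Rightarrow>\<^sub>0 nat)"
  shows "\<exists>i j e. i < j \<and> m j = m i + e"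
proof -
  have "\<exists>r :: nat \<Rightarrow> nat. strict_mono r \<and>
      (\<forall>l\<in>S. \<forall>i j. i \<le> j \<longrightarrow> Poly_Mapping.lookup (m (r i)) l \<le> Poly_Mapping.lookup (m (r j)) l)"
    if "finite S" for S :: "4 set"
    using that
  proof (induction S rule: finite_induct)
    case empty
    show ?case by (auto intro!: exI[of _ id] simp: strict_mono_def)
  next
    case (insert l S)
    then obtain r :: "nat \<Rightarrow> nat" where r: "strict_mono r"
      "\<And>l i j. l \<in> S \<Longrightarrow> i \<le> j \<Longrightarrow> Poly_Mapping.lookup (m (r i)) l \<le> Poly_Mapping.lookup (m (r j)) l" by blast
    obtain g :: "nat \<Rightarrow> nat" where g: "strict_mono g"
      "\<And>i j. i \<le> j \<Longrightarrow> Poly_Mapping.lookup (m (r (g i))) l \<le> Poly_Mapping.lookup (m (r (g j))) l"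
      using incseq_subsequence[of "\<lambda>k. Poly_Mapping.lookup (m (r k)) l"] by blast
    have "g i \<le> g j" if "i \<le> j" for i j using that g(1) by (simp add: strict_mono_less_eq)
    with r g show ?case
      by (intro exI[of _ "\<lambda>k. r (g k)"]) (auto simp: strict_mono_def)
  qed
  from this[of UNIV] obtain r :: "nat \<Rightarrow> nat" where r: "strict_mono r"
    "\<And>l i j. i \<le> j \<Longrightarrow> Poly_Mapping.lookup (m (r i)) l \<le> Poly_Mapping.lookup (m (r j)) l" by auto
  have "m (r 1) = m (r 0) + (m (r 1) - m (r 0))"
    using r(2)[of 0 1] by (intro poly_mapping_eqI) (simp add: lookup_add lookup_minus)
  moreover have "r 0 < r 1" using r(1) by (simp add: strict_mono_def)
  ultimately show ?thesis by blast
qed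

lemma finite_mdeg: "finite {m. mdeg m = d}"
proof -
  have le: "Poly_Mapping.lookup m i \<le> mdeg m" for m :: "4 \<Rightarrow>\<^sub>0 nat" and i
    unfolding mdeg_def by (rule member_le_sum) auto
  have "finite (PiE (UNIV :: 4 set) (\<lambda>_. {..d}))" by (intro finite_PiE) auto
  moreover have "inj (Poly_Mapping.lookup :: (4 \<Rightarrow>\<^sub>0 nat) \<Rightarrow> _)"
    by (rule injI) (rule poly_mapping_eqI, simp)
  ultimately have "finite (Poly_Mapping.lookup -` PiE (UNIV :: 4 set) (\<lambda>_. {..d}))" by (rule finite_vimageI)
  moreover have "{m. mdeg m = d} \<subseteq> Poly_Mapping.lookup -` PiE UNIV (\<lambda>_. {..d})"
    using le by auto
  ultimately show ?thesis by (rule finite_subset[rotated])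
qed

text \<open>
  The Hilbert basis argument: witnesses \<open>G n\<close> with minimal leading monomials and Dickson's lemma.
\<close>

lemma zariski_closed_no_descending_chain:
  assumes closed: "\<And>n. zariski_closed (C n)"
  shows "\<exists>n. \<not> C (Suc n) \<subset> C n"
proof (rule ccontr)
  assume "\<not> ?thesis"
  then have chain: "C (Suc n) \<subset> C n" for n by blast
  then have anti: "C j \<subseteq> C i" if "i \<le> j" for i j using lift_Suc_antimono_le[of C] that by blast
  define van where "van n G \<longleftrightarrow> (\<forall>P\<in>C n. vanishes_at G P)" for n G
  have "\<exists>d. \<exists>G\<in>forms d. van (Suc n) G \<and> \<not> van n G" for n
  proof -
    from closed[of "Suc n"] obtain S where S: "S \<subseteq> (\<Union>d. forms d)" "C (Suc n) = {P. \<forall>G\<in>S. vanishes_at G P}"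
      by (auto simp: zariski_closed_def)
    from chain[of n] obtain P where P: "P \<in> C n" "P \<notin> C (Suc n)" by blast
    with S(2) obtain G where G: "G \<in> S" "\<not> vanishes_at G P" by blast
    with S P show ?thesis unfolding van_def by blast
  qed
  then obtain d where d: "\<And>n. \<exists>G\<in>forms (d n). van (Suc n) G \<and> \<not> van n G" by metis
  define W where "W n = {G \<in> forms (d n). van (Suc n) G \<and> \<not> van n G}" for n
  \<comment> \<open>The order on exponent vectors serves as monomial order: it is linear and
    compatible with addition.\<close>
  define lm where "lm G = Max (Poly_Mapping.keys G)" for G :: cpoly
  have W0: "G \<noteq> 0" if "G \<in> W n" for G n
    using that by (auto simp: W_def van_def vanishes_at_def)
  have lm_keys: "lm G \<in> Poly_Mapping.keys G" if "G \<in> W n" for G n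
    using W0[OF that] unfolding lm_def by (intro Max_in) auto
  \<comment> \<open>A minimum exists because the leading monomials of \<open>W n\<close> lie among
    the finitely many monomials of degree \<open>d n\<close>.\<close>
  have "\<exists>G\<in>W n. \<forall>G'\<in>W n. lm G \<le> lm G'" for n
  proof -
    have "lm ` W n \<subseteq> {m. mdeg m = d n}"
      using lm_keys by (auto simp: W_def forms_iff in_keys_iff)
    then have "finite (lm ` W n)" by (rule finite_subset) (rule finite_mdeg)
    moreover have "lm ` W n \<noteq> {}" using d[of n] by (auto simp: W_def)
    ultimately have Min: "Min (lm ` W n) \<in> lm ` W n" "\<forall>G'\<in>W n. Min (lm ` W n) \<le> lm G'" by auto
    from Min(1) obtain G where "G \<in> W n" "Min (lm ` W n) = lm G" by (rule imageE)
    with Min(2) show ?thesis by (intro bexI[of _ G]) simp_all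
  qed
  then obtain G where G: "\<And>n. G n \<in> W n" "\<And>n G'. G' \<in> W n \<Longrightarrow> lm (G n) \<le> lm G'" by metis
  obtain i j e where ij: "i < j" "lm (G j) = lm (G i) + e" using dickson[of "\<lambda>n. lm (G n)"] by blast
  define a where "a = Poly_Mapping.lookup (G i) (lm (G i))"
  define c where "c = Poly_Mapping.lookup (G j) (lm (G j)) / a"
  have "a \<noteq> 0" using lm_keys[OF G(1)[of i]] by (simp add: a_def in_keys_iff)
  \<comment> \<open>The leading term of \<open>G j\<close> is cancelled. As \<open>i < j\<close>,
    the form \<open>G i\<close> vanishes on \<open>C j\<close>, so \<open>D\<close> agrees with
    \<open>G j\<close> there and stays in \<open>W j\<close>, against the minimality of
    \<open>G j\<close>.\<close>
  define D where "D = G j - G i * Poly_Mapping.single e c"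
  have deg: "d j = d i + mdeg e"
  proof -
    have "mdeg (lm (G j)) = d j" "mdeg (lm (G i)) = d i"
      using G(1)[of j] lm_keys[OF G(1)[of j]] G(1)[of i] lm_keys[OF G(1)[of i]]
      by (auto simp: W_def forms_iff in_keys_iff)
    then show ?thesis using ij(2) by (simp add: mdeg_add)
  qed
  have evalD: "eval (G j) x = eval D x + c * mval e x * eval (G i) x" for x
  proof -
    have "G j = D + G i * Poly_Mapping.single e c" by (simp add: D_def)
    then have "eval (G j) x = eval (D + G i * Poly_Mapping.single e c) x" by simp
    then show ?thesis by (simp add: eval_add eval_mult eval_single)
  qed
  have vi: "vanishes_at (G i) P" if "P \<in> C j" for P
  proof -
    have "P \<in> C (Suc i)" using anti[of "Suc i" j] ij(1) that by auto
    then show ?thesis using G(1)[of i] by (auto simp: W_def van_def)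
  qed
  have "D \<in> W j"
    unfolding W_def
  proof (intro CollectI conjI)
    have "G i * Poly_Mapping.single e c \<in> forms (d j)"
      unfolding deg using G(1)[of i] by (intro forms_mult forms_single) (auto simp: W_def)
    then show "D \<in> forms (d j)" using G(1)[of j] unfolding D_def by (intro forms_diff) (auto simp: W_def)
    show "van (Suc j) D"
      unfolding van_def
    proof
      fix P assume P: "P \<in> C (Suc j)"
      then have "vanishes_at (G j) P" using G(1)[of j] by (auto simp: W_def van_def)
      moreover have "vanishes_at (G i) P" using vi anti[of j "Suc j"] P by auto
      ultimately show "vanishes_at D P" using evalD by (simp add: vanishes_at_def)
    qed
    show "\<not> van j D"
    proof
      assume "van j D"
      then have "van j (G j)" using vi evalD by (simp add: van_def vanishes_at_def)
      with G(1)[of j] show False by (simp add: W_def)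
    qed
  qed
  have lookupD: "Poly_Mapping.lookup D (m + e) = Poly_Mapping.lookup (G j) (m + e) - c * Poly_Mapping.lookup (G i) m" for m
    by (auto simp: D_def lookup_minus lookup_mult_single in_keys_iff)
  have "lm D < lm (G j)"
  proof -
    have "lm D \<in> Poly_Mapping.keys (G j) \<union> Poly_Mapping.keys (G i * Poly_Mapping.single e c)"
      using lm_keys[OF \<open>D \<in> W j\<close>] unfolding D_def by (auto simp: in_keys_iff lookup_minus)
    then have "lm D \<le> lm (G j)"
    proof
      assume "lm D \<in> Poly_Mapping.keys (G j)"
      then show ?thesis unfolding lm_def[of "G j"] by (intro Max_ge) auto
    next
      assume "lm D \<in> Poly_Mapping.keys (G i * Poly_Mapping.single e c)"
      then obtain l where l: "lm D = l + e" "l \<in> Poly_Mapping.keys (G i)"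
        using keys_mult[of "G i" "Poly_Mapping.single e c"] by (auto split: if_splits)
      then have "l \<le> lm (G i)" unfolding lm_def[of "G i"] by (intro Max_ge) auto
      then show ?thesis using l(1) ij(2) by (simp add: add_right_mono)
    qed
    moreover have "lm D \<noteq> lm (G j)"
    proof
      assume "lm D = lm (G j)"
      moreover have "Poly_Mapping.lookup D (lm (G j)) = 0"
        using lookupD[of "lm (G i)"] \<open>a \<noteq> 0\<close> by (simp add: ij(2) c_def a_def)
      ultimately show False using lm_keys[OF \<open>D \<in> W j\<close>] by (simp add: in_keys_iff)
    qed
    ultimately show ?thesis by simp
  qed
  with G(2)[OF \<open>D \<in> W j\<close>] show False by simp
qed

section \<open>Finite and irreducible closed sets\<close>

lemma zariski_closed_finite:
  assumes "finite E"
  shows "zariski_closed E"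
proof -
  define S where "S = {G \<in> \<Union>d. forms d. \<forall>Q\<in>E. vanishes_at G Q}"
  have "P \<in> E" if P: "\<forall>G\<in>S. vanishes_at G P" for P
  proof (rule ccontr)
    assume "P \<notin> E"
    from separating_form[OF assms this] obtain G where "G \<in> S" "\<not> vanishes_at G P"
      unfolding S_def by blast
    with P show False by blast
  qed
  then have "E = {P. \<forall>G\<in>S. vanishes_at G P}" unfolding S_def by blast
  moreover have "S \<subseteq> (\<Union>d. forms d)" by (auto simp: S_def)
  ultimately show ?thesis unfolding zariski_closed_def by blast
qed

lemma zariski_closed_base_locus: "zariski_closed (base_locus d A)"
  unfolding zariski_closed_def base_locus_def forms_through_def by blast

lemma irreducible_closed_singleton: "irreducible_closed {P}"
  unfolding irreducible_closed_def using zariski_closed_finite[of "{P}"] by blast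

lemma irreducible_closed_finite:
  assumes "irreducible_closed E" "finite E" "P \<in> E"
  shows "E = {P}"
proof -
  have "zariski_closed {P}" "zariski_closed (E - {P})" using zariski_closed_finite assms(2) by auto
  moreover have "E = {P} \<union> (E - {P})" using assms(3) by blast
  ultimately have "E = {P} \<or> E = E - {P}" using assms(1) unfolding irreducible_closed_def by blast
  with assms(3) show ?thesis by blast
qed

text \<open>
  A minimal infinite closed set is an irreducible curve, since its proper closed subsets are finite.
\<close>

lemma infinite_closed_contains_curve:
  assumes "zariski_closed Z" "infinite Z"
  shows "\<exists>C. is_curve C \<and> C \<subseteq> Z"
proof -
  define R where "R = {(C, D). zariski_closed C \<and> zariski_closed D \<and> C \<subset> D}"
  have "wf R"
    unfolding wf_iff_no_infinite_down_chain
  proof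
    assume "\<exists>f. \<forall>i. (f (Suc i), f i) \<in> R"
    then obtain f where f: "\<And>i. (f (Suc i), f i) \<in> R" by blast
    have "zariski_closed (f i)" "f (Suc i) \<subset> f i" for i using f[of i] by (simp_all add: R_def)
    then show False using zariski_closed_no_descending_chain[of f] by blast
  qed
  define Q where "Q = {C. zariski_closed C \<and> infinite C \<and> C \<subseteq> Z}"
  have "Z \<in> Q" using assms by (simp add: Q_def)
  obtain C where C': "C \<in> Q" "\<And>D. (D, C) \<in> R \<Longrightarrow> D \<notin> Q"
    using wfE_min[OF \<open>wf R\<close> \<open>Z \<in> Q\<close>] by metis
  then have C: "zariski_closed C" "infinite C" "C \<subseteq> Z" by (simp_all add: Q_def)
  have proper: "finite D" if "zariski_closed D" "D \<subset> C" for D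
    using C'(2)[of D] C(1,3) that by (auto simp: R_def Q_def)
  have irr: "irreducible_closed C"
    unfolding irreducible_closed_def
  proof (intro conjI allI impI)
    show "C \<noteq> {}" using C(2) by auto
    fix Z1 Z2 assume Z: "zariski_closed Z1 \<and> zariski_closed Z2 \<and> C = Z1 \<union> Z2"
    show "C = Z1 \<or> C = Z2"
    proof (rule ccontr)
      assume "\<not> ?thesis"
      then have "finite Z1" "finite Z2" using Z proper by blast+
      with Z C(2) show False by simp
    qed
  qed (fact C(1))
  have "krull_dim C = 1"
    unfolding krull_dim_def
  proof (rule antisym)
    show "Sup {enat n | n. \<exists>K :: nat \<Rightarrow> P3 set. (\<forall>i\<le>n. irreducible_closed (K i) \<and> K i \<subseteq> C) \<and> (\<forall>i<n. K i \<subset> K (Suc i))} \<le> 1"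
    proof (rule Sup_least, clarify)
      fix n and K :: "nat \<Rightarrow> P3 set"
      assume K: "\<forall>i\<le>n. irreducible_closed (K i) \<and> K i \<subseteq> C" "\<forall>i<n. K i \<subset> K (Suc i)"
      \<comment> \<open>In a longer chain \<open>K 1\<close> would be a proper closed subset of
        \<open>C\<close>, so finite, so a single point, which leaves no room for
        \<open>K 0\<close>.\<close>
      have "n \<le> 1"
      proof (rule ccontr)
        assume "\<not> n \<le> 1"
        then have n: "2 \<le> n" by simp
        have K01: "K 0 \<subset> K 1" and K12: "K 1 \<subset> K 2"
          using K(2)[rule_format, of 0] K(2)[rule_format, of 1] n by (simp_all add: numeral_2_eq_2)
        have irrK: "irreducible_closed (K 0)" "irreducible_closed (K 1)" and "K 2 \<subseteq> C" using K(1) n by auto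
        then have "K 1 \<subset> C" using K12 by (rule_tac psubset_subset_trans)
        then have fin: "finite (K 1)" using proper[of "K 1"] irrK(2) by (simp add: irreducible_closed_def)
        from irrK(1) obtain P where P: "P \<in> K 0" by (auto simp: irreducible_closed_def)
        with K01 have "P \<in> K 1" by blast
        from irreducible_closed_finite[OF irrK(2) fin this] K01 have "K 0 \<subset> {P}" by simp
        with P show False by blast
      qed
      then show "enat n \<le> 1" by (simp add: one_enat_def)
    qed
    obtain P where P: "P \<in> C" using C(2) by (metis finite.emptyI all_not_in_conv)
    show "1 \<le> Sup {enat n | n. \<exists>K :: nat \<Rightarrow> P3 set. (\<forall>i\<le>n. irreducible_closed (K i) \<and> K i \<subseteq> C) \<and> (\<forall>i<n. K i \<subset> K (Suc i))}"
    proof (rule Sup_upper, intro CollectI exI[of _ 1] conjI)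
      have "{P} \<subset> C" using P C(2) by (metis finite.emptyI finite.insertI psubsetI empty_subsetI insert_subset)
      then show "\<exists>K :: nat \<Rightarrow> P3 set. (\<forall>i\<le>1. irreducible_closed (K i) \<and> K i \<subseteq> C) \<and> (\<forall>i<1. K i \<subset> K (Suc i))"
        using irr irreducible_closed_singleton[of P] P
        by (intro exI[of _ "\<lambda>i. if i = 0 then {P} else C"]) auto
    qed (simp add: one_enat_def)
  qed
  with irr have "is_curve C" by (simp add: is_curve_def)
  with C(3) show ?thesis by blast
qed


section \<open>Uniqueness of the decomposition\<close>

text \<open>
  The sum over \<open>Z\<close> weighted by negative powers of the first coordinate is a functional on the forms of
  degree \<open>6 + n\<close>. It kills the multiples of the members of \<open>V\<close>, and modulo these every form of degree at least
  \<open>7\<close> is divisible by the first coordinate, so that the degree can be lowered.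
\<close>

lemma relation_all_degrees:
  fixes V :: "(complex \<times> complex \<times> complex \<times> complex \<Rightarrow> complex) set"
  assumes degree3: "V \<subseteq> forms4 3"
    and closed: "\<And>f g c. f \<in> V \<Longrightarrow> g \<in> V \<Longrightarrow> (\<lambda>z. f z + c * g z) \<in> V"
    and base_point_free: "\<And>u. u \<noteq> 0 \<Longrightarrow> \<exists>f\<in>V. f (0, u) \<noteq> 0"
    and nonzero: "\<And>P. P \<in> Z \<Longrightarrow> fst (z P) \<noteq> 0"
    and vanish: "\<And>P f. P \<in> Z \<Longrightarrow> f \<in> V \<Longrightarrow> f (z P) = 0"
    and relation: "\<And>G. G \<in> forms4 6 \<Longrightarrow> (\<Sum>P\<in>Z. c P * G (z P)) = 0"
  shows "G \<in> forms4 (6 + n) \<Longrightarrow> (\<Sum>P\<in>Z. c P * G (z P) / fst (z P) ^ n) = 0"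
proof (induction n arbitrary: G)
  case 0
  then show ?case using relation by simp
next
  case (Suc n)
  define V0 where "V0 = (\<lambda>f u. f (0, u)) ` V"
  interpret cubic_system V0
  proof
    show "V0 \<subseteq> forms3 3" using degree3 ext_at_0[OF graded_forms3] by (auto simp: V0_def)
    show "(\<lambda>z. f z + c * g z) \<in> V0" if "f \<in> V0" "g \<in> V0" for f g c
      using that closed unfolding V0_def by fastforce
    show "\<exists>f\<in>V0. f z \<noteq> 0" if "z \<noteq> 0" for z
      using base_point_free[OF that] by (auto simp: V0_def)
  qed
  \<comment> \<open>Every term keeps a factor from \<open>V\<close> when extended from the plane to
    four variables, so the extension vanishes on \<open>Z\<close>.\<close>
  have lift: "\<exists>H'\<in>forms4 (e + 3). (\<forall>u. H' (0, u) = H u) \<and> (\<forall>P\<in>Z. H' (z P) = 0)"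
    if "H \<in> cubic_multiples V0 e" for H e
    using that
  proof induction
    case zero
    show ?case by (intro bexI[OF _ graded_zero[OF graded_forms4]]) auto
  next
    case (add H f h)
    then obtain H' where H': "H' \<in> forms4 (e + 3)" "\<forall>u. H' (0, u) = H u" "\<forall>P\<in>Z. H' (z P) = 0" by blast
    from add obtain g where g: "g \<in> V" "f = (\<lambda>u. g (0, u))" by (auto simp: V0_def)
    have "(\<lambda>v. g v * h (snd v)) \<in> forms4 (e + 3)"
      using graded_mult[OF graded_forms4 subsetD[OF degree3 g(1)] ext_snd[OF graded_forms3 add.hyps(3)]]
      by (simp add: add.commute)
    from graded_add[OF graded_forms4 H'(1) this] show ?case
      by (rule bexI[rotated]) (use H' g vanish in auto)
  qed
  \<comment> \<open>The degree is \<open>7 + n\<close>, with cofactor degree \<open>4 + n\<close>: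
    the case \<open>n = 0\<close> is the first one in which the multiples fill everything.\<close>
  have "(\<lambda>u. G (0, u)) \<in> forms3 ((4 + n) + 3)" using ext_at_0[OF graded_forms3 Suc.prems] by (simp add: numeral_eq_Suc)
  from lift[OF forms3_eq_cubic_multiples[OF _ this]] obtain H
    where H: "H \<in> forms4 ((4 + n) + 3)" "\<forall>u. H (0, u) = G (0, u)" "\<forall>P\<in>Z. H (z P) = 0" by auto
  have "(\<lambda>v. G v - H v) \<in> forms4 (Suc (6 + n))"
    using graded_diff[OF graded_forms4 Suc.prems, of H] H(1) by (simp add: numeral_eq_Suc)
  from ext_divide[OF graded_forms3 this] H(2) obtain G' where
    G': "G' \<in> forms4 (6 + n)" "(\<lambda>v. G v - H v) = (\<lambda>v. fst v * G' v)" by auto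
  have "c P * G (z P) / fst (z P) ^ Suc n = c P * G' (z P) / fst (z P) ^ n" if "P \<in> Z" for P
    using fun_cong[OF G'(2), of "z P"] H(3) nonzero[OF that] that by simp
  then show ?case using Suc.IH[OF G'(1)] by simp
qed

text \<open>The first coordinate is the linear form with coefficients
  \<open>1, m, m ^ 2, m ^ 3\<close>. At a fixed point it is a nonzero polynomial in
  \<open>m\<close>, so a suitable \<open>m\<close> keeps the plane away from any given finite
  set.\<close>

definition coord :: "complex \<Rightarrow> complex ^ 4 \<Rightarrow> complex \<times> complex \<times> complex \<times> complex" where
  "coord m x = (x $ 1 + m * x $ 2 + m\<^sup>2 * x $ 3 + m ^ 3 * x $ 4, x $ 2, x $ 3, x $ 4)"

definition uncoord :: "complex \<Rightarrow> complex \<times> complex \<times> complex \<times> complex \<Rightarrow> complex ^ 4" where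
  "uncoord m = (\<lambda>(w, r, s, t). vector [w - m * r - m\<^sup>2 * s - m ^ 3 * t, r, s, t])"

lemma vector_4 [simp]:
  "(vector [x1, x2, x3, x4] :: 'a::zero ^ 4) $ 1 = x1"
  "(vector [x1, x2, x3, x4] :: 'a::zero ^ 4) $ 2 = x2"
  "(vector [x1, x2, x3, x4] :: 'a::zero ^ 4) $ 3 = x3"
  "(vector [x1, x2, x3, x4] :: 'a::zero ^ 4) $ 4 = x4"
  by (simp_all add: vector_def)

lemma uncoord_coord [simp]: "uncoord m (coord m x) = x"
  by (simp add: coord_def uncoord_def vec_eq_iff forall_4)

lemma coord_uncoord [simp]: "coord m (uncoord m z) = z"
  by (cases z) (simp add: coord_def uncoord_def)

lemma uncoord_coordinate: "(\<lambda>z. uncoord m z $ i) \<in> forms4 1"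
proof -
  have w: "(\<lambda>z. fst z) \<in> forms4 1" using fst_in_ext[OF graded_forms3] by simp
  have r: "(\<lambda>z. fst (snd z)) \<in> forms4 1" using ext_snd[OF graded_forms3 fst_in_ext[OF graded_forms2]] by simp
  have s: "(\<lambda>z. fst (snd (snd z))) \<in> forms4 1" and t: "(\<lambda>z. snd (snd (snd z))) \<in> forms4 1"
    using ext_snd[OF graded_forms3 ext_snd[OF graded_forms2 fst_snd_in_forms2(1)]]
      ext_snd[OF graded_forms3 ext_snd[OF graded_forms2 fst_snd_in_forms2(2)]] by simp_all
  note gr = graded_forms4
  have "(\<lambda>z. fst z - m * fst (snd z) - m\<^sup>2 * fst (snd (snd z)) - m ^ 3 * snd (snd (snd z))) \<in> forms4 1"
    by (intro graded_diff[OF gr] graded_scale[OF gr] w r s t)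
  with r s t show ?thesis
    using exhaust_4[of i] by (auto simp: uncoord_def case_prod_beta)
qed

lemma eval_uncoord:
  assumes "G \<in> forms d"
  shows "(\<lambda>z. eval G (uncoord m z)) \<in> forms4 d"
proof -
  have "(\<lambda>z. Poly_Mapping.lookup G l * mval l (uncoord m z)) \<in> forms4 d" if "l \<in> Poly_Mapping.keys G" for l
  proof -
    have "(\<lambda>z. \<Prod>i\<in>UNIV. uncoord m z $ i ^ Poly_Mapping.lookup l i) \<in> forms4 (\<Sum>i\<in>UNIV. Poly_Mapping.lookup l i)"
      using graded_power[OF graded_forms4 uncoord_coordinate]
      by (intro graded_prod[OF graded_forms4]) simp_all
    moreover have "mdeg l = d" using that assms by (auto simp: forms_iff in_keys_iff)
    ultimately show ?thesis
      unfolding mval_def by (intro graded_scale[OF graded_forms4]) (simp add: mdeg_def)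
  qed
  then show ?thesis
    unfolding eval_def mval_def[symmetric] by (intro graded_sum[OF graded_forms4])
qed

lemma forms4_coord:
  assumes "G \<in> forms4 d"
  shows "(\<lambda>x. G (coord m x)) \<in> form_functions d"
proof -
  note gr = graded_form_functions and co = coordinate_form_function
  have w: "(\<lambda>x. x $ 1 + m * x $ 2 + m\<^sup>2 * x $ 3 + m ^ 3 * x $ 4) \<in> form_functions 1"
    by (intro graded_add[OF gr] graded_scale[OF gr] co)
  have 1: "(\<lambda>x. q (x $ 4)) \<in> form_functions e" if "q \<in> forms1 e" for q e
  proof -
    from that obtain c where "q = (\<lambda>t. c * t ^ e)" by (auto simp: forms1_def)
    then show ?thesis using graded_scale[OF gr graded_power[OF gr co[of 4], of e], of c] by simp
  qed
  have 2: "(\<lambda>x. q (x $ 3, x $ 4)) \<in> form_functions e" if "q \<in> forms2 e" for q e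
    by (rule ext_comp[OF gr co 1 that])
  have 3: "(\<lambda>x. q (x $ 2, x $ 3, x $ 4)) \<in> form_functions e" if "q \<in> forms3 e" for q e
    by (rule ext_comp[OF gr co 2 that])
  show ?thesis
    unfolding coord_def by (rule ext_comp[OF gr w 3 assms])
qed

text \<open>Once the relation has been carried to degree \<open>6 + card Z\<close>, there is room
  for a product of linear forms that vanishes on \<open>Z\<close> except at \<open>P0\<close>, which
  isolates the weight of \<open>P0\<close>.\<close>

lemma sextics_separate:
  assumes fin: "finite (base_locus 3 A)" and Z: "Z \<subseteq> base_locus 3 A"
    and relation: "\<And>G. G \<in> forms 6 \<Longrightarrow> (\<Sum>P\<in>Z. c P * eval G (rep_P3 P)) = 0"
    and P0: "P0 \<in> Z"
  shows "c P0 = 0"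
proof -
  let ?x = "rep_P3"
  define p where "p P = [:?x P $ 1, ?x P $ 2, ?x P $ 3, ?x P $ 4:]" for P
  have coord_p: "fst (coord m (?x P)) = poly (p P) m" for m P
    by (simp add: coord_def p_def algebra_simps power2_eq_square power3_eq_cube)
  have "p P \<noteq> 0" for P
    using rep_P3_nonzero[of P] by (auto simp: p_def vec_eq_iff forall_4)
  then have "finite (\<Union>P\<in>base_locus 3 A. {m. poly (p P) m = 0})"
    using fin by (auto intro: poly_roots_finite)
  from ex_new_if_finite[OF infinite_UNIV_char_0 this] obtain m
    where m: "\<And>P. P \<in> base_locus 3 A \<Longrightarrow> fst (coord m (?x P)) \<noteq> 0"
    unfolding coord_p by blast
  define V where "V = (\<lambda>G z. eval G (uncoord m z)) ` forms_through 3 A"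
  have V: "V \<subseteq> forms4 3" using eval_uncoord by (auto simp: V_def forms_through_def)
  have closed: "(\<lambda>z. f z + c * g z) \<in> V" if "f \<in> V" "g \<in> V" for f g c
  proof -
    from that obtain F G where FG: "F \<in> forms_through 3 A" "G \<in> forms_through 3 A"
      "f = (\<lambda>z. eval F (uncoord m z))" "g = (\<lambda>z. eval G (uncoord m z))" by (auto simp: V_def)
    then have "F + cscale c G \<in> forms_through 3 A"
      by (auto simp: forms_through_def vanishes_at_def eval_add eval_cscale intro: forms_add forms_cscale)
    then show ?thesis unfolding V_def by (rule image_eqI[rotated]) (simp add: FG eval_add eval_cscale)
  qed
  have bpf: "\<exists>f\<in>V. f (0, u) \<noteq> 0" if "u \<noteq> 0" for u
  proof -
    \<comment> \<open>A common zero of the restricted system would be a base point on the plane,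
      which the choice of \<open>m\<close> excludes.\<close>
    define x where "x = uncoord m (0, u)"
    have cx: "coord m x = (0, u)" by (simp add: x_def)
    have "x \<noteq> 0"
    proof
      assume "x = 0"
      then have "coord m x = 0" by (simp add: coord_def zero_prod_def)
      with cx that show False by (simp add: zero_prod_def)
    qed
    obtain k where "?x (abs_P3 x) = k *s x" using rep_abs_P3[OF \<open>x \<noteq> 0\<close>] by blast
    then have "fst (coord m (?x (abs_P3 x))) = k * fst (coord m x)" by (simp add: coord_def algebra_simps)
    then have "abs_P3 x \<notin> base_locus 3 A" using m cx by auto
    then obtain G where G: "G \<in> forms_through 3 A" "\<not> vanishes_at G (abs_P3 x)" by (auto simp: base_locus_def)
    then have "eval G x \<noteq> 0" using vanishes_at_abs[of G 3] \<open>x \<noteq> 0\<close> by (simp add: forms_through_def)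
    then show ?thesis using G(1) by (auto simp: V_def x_def)
  qed
  have van: "f (coord m (?x P)) = 0" if "P \<in> Z" "f \<in> V" for P f
    using that Z by (auto simp: V_def base_locus_def vanishes_at_def)
  have rel: "(\<Sum>P\<in>Z. c P * G (coord m (?x P))) = 0" if "G \<in> forms4 6" for G
    using forms4_coord[OF that, of m] relation by (auto simp: form_functions_def fun_eq_iff)
  have nonz: "fst (coord m (?x P)) \<noteq> 0" if "P \<in> Z" for P using m that Z by auto
  have "finite Z" using fin Z by (rule finite_subset[rotated])
  then obtain G where G: "G \<in> forms (card (Z - {P0}))" "\<forall>Q\<in>Z - {P0}. vanishes_at G Q" "\<not> vanishes_at G P0"
    using separating_form[of "Z - {P0}" P0] by blast
  \<comment> \<open>\<open>G\<close> has degree \<open>card Z - 1\<close>. The factor of degree 7,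
    nonzero on \<open>Z\<close>, raises it to \<open>6 + n\<close> with
    \<open>n = card Z\<close>.\<close>
  define H where "H z = fst z ^ 7 * eval G (uncoord m z)" for z
  have card_Z: "1 * 7 + card (Z - {P0}) = 6 + card Z" using card_Suc_Diff1[OF \<open>finite Z\<close> P0] by simp
  have H: "H \<in> forms4 (6 + card Z)"
    unfolding H_def card_Z[symmetric] by (intro graded_mult[OF graded_forms4] graded_power[OF graded_forms4]
        fst_in_ext[OF graded_forms3] eval_uncoord G(1))
  have "0 = (\<Sum>P\<in>Z. c P * H (coord m (?x P)) / fst (coord m (?x P)) ^ card Z)"
    by (rule relation_all_degrees[of V, symmetric]) (rule V closed bpf nonz van rel H; assumption)+
  also have "\<dots> = c P0 * H (coord m (?x P0)) / fst (coord m (?x P0)) ^ card Z"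
    using \<open>finite Z\<close> P0 G(2)
    by (subst sum.remove[of Z P0]) (auto intro!: sum.neutral simp: H_def vanishes_at_def)
  finally show ?thesis
    using nonz[OF P0] G(3) by (simp add: H_def vanishes_at_def)
qed

text \<open>
  The values of \<open>W\<close> on \<open>A' \<union> B'\<close> form an isotropic space for the quadratic form with weights \<open>c\<close>, and
  \<open>A'\<close> makes up at least half of the points.
\<close>

lemma isotropic_vanishing:
  fixes c :: "'p \<Rightarrow> 'a::field"
  assumes fin: "finite A'" "finite B'" and disj: "A' \<inter> B' = {}" and card: "card B' \<le> card A'"
    and nonzero: "\<And>P. P \<in> A' \<union> B' \<Longrightarrow> c P \<noteq> 0"
    and isotropic: "\<And>f g. f \<in> W \<Longrightarrow> g \<in> W \<Longrightarrow> (\<Sum>P\<in>A' \<union> B'. c P * f P * g P) = 0"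
    and separate: "\<And>P. P \<in> A' \<Longrightarrow> \<exists>w\<in>W. w P \<noteq> 0 \<and> (\<forall>Q\<in>A' - {P}. w Q = 0)"
    and f: "f \<in> W" "\<And>P. P \<in> A' \<Longrightarrow> f P = 0"
    and R: "R \<in> B'"
  shows "f R = 0"
proof -
  from separate obtain w where w: "\<And>P. P \<in> A' \<Longrightarrow> w P \<in> W" "\<And>P. P \<in> A' \<Longrightarrow> w P P \<noteq> 0"
    "\<And>P Q. P \<in> A' \<Longrightarrow> Q \<in> A' \<Longrightarrow> Q \<noteq> P \<Longrightarrow> w P Q = 0" by (metis Diff_iff singletonD)
  \<comment> \<open>These are \<open>card A' + 1\<close> functions, \<open>None\<close> standing for
    \<open>f\<close>. As \<open>B'\<close> has at most \<open>card A'\<close> points, a nontrivial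
    combination vanishes on \<open>B'\<close>.\<close>
  define g where "g i = (case i of None \<Rightarrow> f | Some P \<Rightarrow> w P)" for i
  define I where "I = insert None (Some ` A')"
  have finI: "finite I" using fin by (simp add: I_def)
  have "card I = Suc (card A')" using fin by (simp add: I_def card_image)
  with card have "card B' < card I" by simp
  from nontrivial_solution[OF fin(2) finI this, of g] obtain x where
    x: "\<exists>i\<in>I. x i \<noteq> 0" "\<And>Q. Q \<in> B' \<Longrightarrow> (\<Sum>i\<in>I. x i * g i Q) = 0" by blast
  have gW: "g i \<in> W" if "i \<in> I" for i using that w f by (auto simp: g_def I_def)
  \<comment> \<open>By isotropy the pairing over \<open>B'\<close> is minus the one over
    \<open>A'\<close>, where \<open>w Q\<close> sees only the point \<open>Q\<close>.\<close>
  have on_B: "(\<Sum>S\<in>B'. c S * w Q S * h S) = - (c Q * w Q Q * h Q)" if "Q \<in> A'" "h \<in> W" for Q h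
  proof -
    have "0 = (\<Sum>S\<in>A'. c S * w Q S * h S) + (\<Sum>S\<in>B'. c S * w Q S * h S)"
      using isotropic[OF w(1)[OF that(1)] that(2)] fin disj by (simp add: sum.union_disjoint)
    also have "(\<Sum>S\<in>A'. c S * w Q S * h S) = c Q * w Q Q * h Q"
      using fin that w(3) by (subst sum.remove[of A' Q]) auto
    finally show ?thesis by (simp add: eq_neg_iff_add_eq_0 add.commute)
  qed
  \<comment> \<open>The combination pairs to 0 with \<open>w Q\<close> over \<open>B'\<close>. Moved
    to \<open>A'\<close>, this pairing retains only the term of \<open>w Q\<close>, as
    \<open>f\<close> and the other functions vanish at \<open>Q\<close>. In the end only the
    multiple of \<open>f\<close> is left.\<close>
  have x_zero: "x (Some Q) = 0" if Q: "Q \<in> A'" for Q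
  proof -
    have "0 = (\<Sum>S\<in>B'. c S * w Q S * (\<Sum>i\<in>I. x i * g i S))" using x(2) by simp
    also have "\<dots> = (\<Sum>S\<in>B'. \<Sum>i\<in>I. x i * (c S * w Q S * g i S))"
      by (simp add: sum_distrib_left mult_ac)
    also have "\<dots> = (\<Sum>i\<in>I. x i * (\<Sum>S\<in>B'. c S * w Q S * g i S))"
      by (subst sum.swap) (simp add: sum_distrib_left)
    also have "\<dots> = (\<Sum>i\<in>I. x i * - (c Q * w Q Q * g i Q))"
      by (rule sum.cong) (use on_B[OF Q gW] in auto)
    also have "\<dots> = x (Some Q) * - (c Q * w Q Q * g (Some Q) Q)"
    proof (subst sum.mono_neutral_right[of I "{Some Q}"])
      have "g i Q = 0" if "i \<in> I - {Some Q}" for i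
        using that f(2)[OF Q] w(3)[OF _ Q] by (cases i) (auto simp: I_def g_def)
      then show "\<forall>i\<in>I - {Some Q}. x i * - (c Q * w Q Q * g i Q) = 0" by simp
    qed (use finI Q in \<open>auto simp: I_def\<close>)
    also have "g (Some Q) Q = w Q Q" by (simp add: g_def)
    finally show ?thesis using nonzero[of Q] w(2)[OF Q] Q by simp
  qed
  have "x None \<noteq> 0" using x(1) x_zero by (auto simp: I_def)
  moreover have "(\<Sum>i\<in>I. x i * g i R) = x None * f R"
    using fin x_zero by (simp add: I_def g_def sum.reindex)
  ultimately show ?thesis using x(2)[OF R] by simp
qed

text \<open>Up to \<open>20 = (3 + 3) choose 3\<close> points the Hilbert function in degree 3
  counts points. Hence dropping \<open>P\<close> changes it, and with it the set of cubics through
  the points.\<close>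

lemma separating_cubic:
  assumes "general_position A" "card A \<le> 20" "A' \<subseteq> A" "P \<in> A'"
  shows "\<exists>G\<in>forms 3. \<not> vanishes_at G P \<and> (\<forall>Q\<in>A' - {P}. vanishes_at G Q)"
proof -
  have fin: "finite A" using assms(1) by (simp add: general_position_def)
  have h: "hilbert_function S 3 = card S" if "S \<subseteq> A" for S
  proof -
    have "card S \<le> 20" using card_mono[OF fin that] assms(2) by simp
    moreover have "(3 + 3 :: nat) choose 3 = 20" by (simp add: numeral_eq_Suc)
    ultimately show ?thesis using assms(1) that by (simp add: general_position_def)
  qed
  have "card (A' - {P}) < card A'"
    using finite_subset[OF assms(3) fin] assms(4) by (rule card_Diff1_less)
  then have "hilbert_function (A' - {P}) 3 \<noteq> hilbert_function A' 3" using h[OF assms(3)] h[OF subset_trans[OF Diff_subset assms(3)]] by simp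
  then have "forms_through 3 (A' - {P}) \<noteq> forms_through 3 A'" by (auto simp: hilbert_function_def)
  moreover have "forms_through 3 A' \<subseteq> forms_through 3 (A' - {P})" by (auto simp: forms_through_def)
  ultimately obtain G where "G \<in> forms_through 3 (A' - {P})" "G \<notin> forms_through 3 A'" by blast
  then show ?thesis by (auto simp: forms_through_def)
qed

text \<open>The bound 20 is the dimension of the space of cubics and covers both 16 and 17.
  Admitting every \<open>card B \<le> card A\<close> settles the rank together with
  uniqueness.\<close>

lemma decomposition_unique:
  assumes nonred: "nonredundant_decomposition F A" and gp: "general_position A" and cardA: "card A \<le> 20"
    and fin: "finite (base_locus 3 A)"
    and B: "decomposition F B" "card B \<le> card A"
  shows "B = A"
proof -
  from nonred obtain a where a: "finite A" "\<And>P. P \<in> A \<Longrightarrow> a P \<noteq> 0" "F = (\<Sum>P\<in>A. cscale (a P) (veronese6 P))"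
    by (auto simp: nonredundant_decomposition_def)
  from B obtain b where b: "finite B" "F = (\<Sum>P\<in>B. cscale (b P) (veronese6 P))"
    by (auto simp: decomposition_def)
  \<comment> \<open>Coefficients are extended by 0 and may cancel on \<open>A \<inter> B\<close>.
    Passing to the support \<open>Z\<close> makes all weights nonzero, and \<open>A - B\<close>
    survives because \<open>a\<close> is nonzero on \<open>A\<close>.\<close>
  define c where "c P = (if P \<in> A then a P else 0) - (if P \<in> B then b P else 0)" for P
  define Z where "Z = {P \<in> A \<union> B. c P \<noteq> 0}"
  have finZ: "finite Z" using a b by (simp add: Z_def)
  have ext_sum: "(\<Sum>P\<in>A \<union> B. cscale (if P \<in> S then d P else 0) (veronese6 P)) = (\<Sum>P\<in>S. cscale (d P) (veronese6 P))"
    if "S \<subseteq> A \<union> B" for S d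
    by (rule sum.mono_neutral_cong_right) (use a b that in auto)
  have "(\<Sum>P\<in>Z. cscale (c P) (veronese6 P)) = (\<Sum>P\<in>A \<union> B. cscale (c P) (veronese6 P))"
    by (rule sum.mono_neutral_left) (use a b in \<open>auto simp: Z_def\<close>)
  also have "\<dots> = (\<Sum>P\<in>A \<union> B. cscale (if P \<in> A then a P else 0) (veronese6 P))
      - (\<Sum>P\<in>A \<union> B. cscale (if P \<in> B then b P else 0) (veronese6 P))"
    by (simp only: c_def cpoly.scale_left_diff_distrib sum_subtractf)
  also have "\<dots> = 0" using a(3) b(2) by (simp add: ext_sum)
  finally have rel: "(\<Sum>P\<in>Z. cscale (c P) (linform (rep_P3 P) ^ 6)) = 0" by (simp add: veronese6_def)
  note apolar = relation_eval[OF rel]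
  define A' where "A' = Z \<inter> A"
  define B' where "B' = Z - A"
  have Z_split: "Z = A' \<union> B'" by (auto simp: A'_def B'_def)
  have A_sub: "A - B \<subseteq> A'" using a(2) by (auto simp: A'_def Z_def c_def)
  have B_sub: "B' \<subseteq> B - A" by (auto simp: B'_def Z_def)
  have "card B' \<le> card (B - A)" using B_sub b(1) by (intro card_mono) auto
  \<comment> \<open>The common points count equally in \<open>A\<close> and in
    \<open>B\<close>.\<close>
  also have "card (B - A) \<le> card (A - B)"
    using a(1) b(1) B(2) card_Int_Diff[of A B] card_Int_Diff[of B A] by (simp add: Int_commute)
  also have "card (A - B) \<le> card A'" using A_sub finZ by (intro card_mono) (auto simp: A'_def)
  finally have card': "card B' \<le> card A'" .
  have Z_base: "Z \<subseteq> base_locus 3 A"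
  proof
    fix R assume R: "R \<in> Z"
    have "vanishes_at G R" if G: "G \<in> forms_through 3 A" for G
    proof (cases "R \<in> A")
      case True
      then show ?thesis using G by (simp add: forms_through_def)
    next
      case False
      define W where "W = (\<lambda>G P. eval G (rep_P3 P)) ` forms 3"
      have "eval G (rep_P3 R) = 0"
      proof (rule isotropic_vanishing[of A' B' c W "\<lambda>P. eval G (rep_P3 P)"])
        show "finite A'" "finite B'" "A' \<inter> B' = {}" using finZ by (auto simp: A'_def B'_def)
        show "R \<in> B'" using R False by (simp add: B'_def)
        show "card B' \<le> card A'" by (fact card')
        show "c P \<noteq> 0" if "P \<in> A' \<union> B'" for P using that unfolding Z_split[symmetric] by (simp add: Z_def)
        show "(\<lambda>P. eval G (rep_P3 P)) \<in> W" using G by (simp add: W_def forms_through_def)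
        show "eval G (rep_P3 P) = 0" if "P \<in> A'" for P
          using that G by (simp add: A'_def forms_through_def vanishes_at_def)
        show "(\<Sum>P\<in>A' \<union> B'. c P * f P * g P) = 0" if fg: "f \<in> W" "g \<in> W" for f g
        proof -
          from fg obtain H K where HK: "H \<in> forms 3" "K \<in> forms 3"
            "f = (\<lambda>P. eval H (rep_P3 P))" "g = (\<lambda>P. eval K (rep_P3 P))" by (auto simp: W_def)
          have "H * K \<in> forms 6" using forms_mult[OF HK(1,2)] by simp
          from apolar[OF this] show ?thesis by (simp add: HK eval_mult Z_split mult.assoc)
        qed
        show "\<exists>w\<in>W. w P \<noteq> 0 \<and> (\<forall>Q\<in>A' - {P}. w Q = 0)" if P: "P \<in> A'" for P
        proof -
          have "A' \<subseteq> A" by (simp add: A'_def)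
          from separating_cubic[OF gp cardA this P] show ?thesis
            by (auto simp: W_def vanishes_at_def)
        qed
      qed
      then show ?thesis by (simp add: vanishes_at_def)
    qed
    then show "R \<in> base_locus 3 A" by (simp add: base_locus_def)
  qed
  have "Z = {}"
  proof (rule ccontr)
    assume "Z \<noteq> {}"
    then obtain P where "P \<in> Z" by blast
    from sextics_separate[OF fin Z_base apolar this] have "c P = 0" by simp
    with \<open>P \<in> Z\<close> show False by (simp add: Z_def)
  qed
  then have "A \<subseteq> B" using A_sub by (auto simp: A'_def)
  with B(2) b(1) show ?thesis by (metis card_seteq)
qed

theorem proposition4p4:
  fixes F :: cpoly and A :: "P3 set" and r :: nat
  assumes "r = 16 \<or> r = 17"
    and "F \<in> forms 6"
    and "nonredundant_decomposition F A"
    and "card A = r"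
    and "general_position A"
    and "\<not> (\<exists>C. is_curve C \<and> C \<subseteq> base_locus 3 A)"
  shows "waring_rank F = r \<and> (\<forall>B. minimal_decomposition F B \<longleftrightarrow> B = A)"
proof -
  have "finite (base_locus 3 A)"
    using infinite_closed_contains_curve[OF zariski_closed_base_locus] assms(6) by blast
  then have unique: "B = A" if "decomposition F B" "card B \<le> r" for B
    using decomposition_unique[of F A B] assms that by auto
  have A: "decomposition F A"
    using assms(3) by (auto simp: nonredundant_decomposition_def decomposition_def)
  have rank: "waring_rank F = r"
    unfolding waring_rank_def
  proof (rule Least_equality)
    show "\<exists>B. decomposition F B \<and> card B = r" using A assms(4) by blast
    show "r \<le> k" if "\<exists>B. decomposition F B \<and> card B = k" for k
    proof (rule ccontr)
      assume "\<not> r \<le> k"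
      with that obtain B where "decomposition F B" "card B < r" by auto
      with unique[of B] assms(4) show False by auto
    qed
  qed
  have "minimal_decomposition F B \<longleftrightarrow> B = A" for B
    unfolding minimal_decomposition_def rank using A assms(4) unique[of B] by auto
  with rank show ?thesis by blast
qed

end
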